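(* Let $\mathcal{B}$ and $\mathcal{B}'$ be a pair of RKBSs on $X$ and $X'$ respectively, let $K:X\times X'\to\mathbb{R}$ be the reproducing kernel for $\mathcal{B}$, let $\mathcal{B}_*$ be a pre-dual space of $\mathcal{B}$, let $\nu_1,\dots,\nu_n\in\mathcal{B}_*$ be linearly independent, and put $\mathcal{V}:=\mathrm{span}\{\nu_1,\dots,\nu_n\}$ and $\mathcal{L}(f):=[\langle\nu_j,f\rangle_{\mathcal{B}}]_{j=1}^n\in\mathbb{R}^n$ for $f\in\mathcal{B}$. Let $\mathbf{y}_0\in\mathbb{R}^n$, $\lambda>0$, let $\mathcal{Q}_{\mathbf{y}_0}:\mathbb{R}^n\to\mathbb{R}_+$ be lower semi-continuous, and let $\varphi:\mathbb{R}_+\to\mathbb{R}_+$ be lower semi-continuous, increasing (not necessarily strictly) and coercive ($\lim_{t\to+\infty}\varphi(t)=+\infty$). Let $\mathrm{R}(\mathbf{y}_0)$ be the set of minimizers over $f\in\mathcal{B}$ of $$\mathcal{Q}_{\mathbf{y}_0}(\mathcal{L}(f))+\lambda\varphi(\|f\|_{\mathcal{B}}),$$ and $\mathcal{D}_{\lambda,\mathbf{y}_0}:=\mathcal{L}(\mathrm{R}(\mathbf{y}_0))$. Suppose that Assumption (A1) holds, and that Assumption (A2) holds with a positive constant $C$. Then: 1. If $\mathcal{D}_{\lambda,\mathbf{y}_0}\neq\{\mathbf{0}\}$, then there exists $\hat f\in\mathrm{R}(\mathbf{y}_0)$ such that $$\hat f=\sum_{j=1}^M\hat\alpha_jK(\cdot,x_j')\qquad(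 * )$$ for some nonzero $\hat\nu\in\mathcal{V}$, some positive integer $M\le\mathrm{rank}(\mathbf{L}_{\hat\nu})$, some $x_j'\in X'_{\hat\nu}$, $j=1,\dots,M$, and some $\hat\alpha_j\neq0$, $j=1,\dots,M$, with $\sum_{j=1}^M|\hat\alpha_j|=\|\hat\nu\|_{\mathcal{B}_*}/C$. 2. If both $\mathcal{Q}_{\mathbf{y}_0}$ and $\varphi$ are convex and $\varphi$ is strictly increasing, then every nonzero extreme point $\hat f$ of $\mathrm{R}(\mathbf{y}_0)$ has the form $( * )$ for some nonzero $\hat\nu\in\mathcal{V}$, some positive integer $M\le\mathrm{rank}(\mathbf{L}_{\hat\nu})$, some $x_j'\in X'_{\hat\nu}$, $j=1,\dots,M$, and some $\hat\alpha_j\neq0$, $j=1,\dots,M$, with $\sum_{j=1}^M|\hat\alpha_j|=\|\hat\nu\|_{\mathcal{B}_*}/C$.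
   Context: All spaces are real; $\mathbb{R}_+=[0,+\infty)$. A Banach space of functions on a set $X$ is a Banach space whose elements are functions on $X$ such that $\|f\|=0$ implies $f(x)=0$ for all $x\in X$. It is an RKBS (reproducing kernel Banach space) on $X$ if every point evaluation $\delta_x$, $x\in X$, is continuous. The $\delta$-dual space $\mathcal{B}'$ of an RKBS $\mathcal{B}$ is the norm closure of $\mathrm{span}\{\delta_x:x\in X\}$ in $\mathcal{B}^*$; it is assumed isometrically isomorphic to a Banach space of functions on a set $X'$ and is identified with that space. The reproducing kernel for $\mathcal{B}$ is the unique function $K:X\times X'\to\mathbb{R}$ with $K(x,\cdot)\in\mathcal{B}'$ and $f(x)=\langle K(x,\cdot),f\rangle_{\mathcal{B}}$ for all $x\in X$, $f\in\mathcal{B}$. If moreover $\mathcal{B}'$ is an RKBS on $X'$, $K(\cdot,x')\in\mathcal{B}$ for all $x'\in X'$, and $g(x')=\langle g,K(\cdot,x')\rangle_{\mathcal{B}}$ for all $g\in\mathcal{B}'$, $x'\in X'$, then $\mathcal{B}'$ is called an adjoint RKBS of $\mathcal{B}$, and $\mathcal{B},\mathcal{B}'$ a pair of RKBSs. A pre-dual space of $\mathcal{B}$ is a Banach space $\mathcal{B}_*$ with $(\mathcal{B}_* )^*=\mathcal{B}$ (isometric identification); elements of $\mathcal{B}_*$ act on $\mathcal{B}$ by $\langle\nu,f\rangle_{\mathcal{B}}=\langle f,\nu\rangle_{\mathcal{B}_*}$. $\partial\|\cdot\|_{\mathcal{B}_*}(\nu)\subset\mathcal{B}$ is the subdifferential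 of the norm of $\mathcal{B}_*$ at $\nu$; $\mathrm{ext}(A)$ is the set of extreme points of a convex set $A$. Assumption (A1): for every nonzero $\nu\in\mathcal{V}$ there exists a finite subset $X'_\nu$ of $X'$ (fixed once and for all) such that $\mathrm{ext}(\partial\|\cdot\|_{\mathcal{B}_*}(\nu))\subset\{-K(\cdot,x'),K(\cdot,x'):x'\in X'_\nu\}$. Assumption (A2): there is a constant $C>0$ such that for all $m\in\mathbb{N}$, all distinct $x_1',\dots,x_m'\in X'$ and all $\boldsymbol{\alpha}\in\mathbb{R}^m$, $\bigl\|\sum_{j=1}^m\alpha_jK(\cdot,x_j')\bigr\|_{\mathcal{B}}=C\|\boldsymbol{\alpha}\|_1$. For nonzero $\nu\in\mathcal{V}$, let $n(\nu)$ be the cardinality of $X'_\nu$, enumerate $X'_\nu=\{t_1',\dots,t_{n(\nu)}'\}$, and set $\mathbf{L}_\nu:=[\langle\nu_i,K(\cdot,t_j')\rangle_{\mathcal{B}}]_{1\le i\le n,\,1\le j\le n(\nu)}\in\mathbb{R}^{n\times n(\nu)}$. *)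

theory Defs
  imports "HOL-Analysis.Analysis"
begin

text \<open>
  A Banach space of functions on a set \<open>X\<close> is a type \<open>'b::banach\<close> with an evaluation map
  \<open>ev f x\<close>, the value at \<open>x \<in> X\<close> of the function \<open>f\<close>. The vector space operations are the
  pointwise ones, and an element is determined by its values on \<open>X\<close>. The requirement that
  \<open>norm f = 0\<close> implies \<open>ev f x = 0\<close> for \<open>x \<in> X\<close> is a consequence of linearity, since the norm
  of the type class vanishes only at \<open>0\<close>. Values of \<open>ev f\<close> outside \<open>X\<close> are irrelevant.
\<close>

definition banach_space_of_functions :: "'x set \<Rightarrow> ('b::banach \<Rightarrow> 'x \<Rightarrow> real) \<Rightarrow> bool" where
  "banach_space_of_functions X ev \<longleftrightarrow>
     (\<forall>x\<in>X. linear (\<lambda>f. ev f x)) \<and>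
     (\<forall>f g. (\<forall>x\<in>X. ev f x = ev g x) \<longrightarrow> f = g)"

definition rkbs :: "'x set \<Rightarrow> ('b::banach \<Rightarrow> 'x \<Rightarrow> real) \<Rightarrow> bool" where
  "rkbs X ev \<longleftrightarrow>
     banach_space_of_functions X ev \<and> (\<forall>x\<in>X. continuous_on UNIV (\<lambda>f. ev f x))"

text \<open>A function \<open>h\<close> on \<open>X\<close> belongs to the space if it is the function of some element; this
  element is then unique.\<close>

definition belongs :: "'x set \<Rightarrow> ('b::banach \<Rightarrow> 'x \<Rightarrow> real) \<Rightarrow> ('x \<Rightarrow> real) \<Rightarrow> bool" where
  "belongs X ev h \<longleftrightarrow> (\<exists>f. \<forall>x\<in>X. ev f x = h x)"

definition element :: "'x set \<Rightarrow> ('b::banach \<Rightarrow> 'x \<Rightarrow> real) \<Rightarrow> ('x \<Rightarrow> real) \<Rightarrow> 'b" where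
  "element X ev h = (THE f. \<forall>x\<in>X. ev f x = h x)"

lemma element_eq_iff:
  assumes "banach_space_of_functions X ev" and "belongs X ev h"
  shows "element X ev h = f \<longleftrightarrow> (\<forall>x\<in>X. ev f x = h x)"
proof -
  obtain f0 where f0: "\<forall>x\<in>X. ev f0 x = h x"
    using assms(2) unfolding belongs_def by blast
  have unique: "g = f0" if "\<forall>x\<in>X. ev g x = h x" for g
  proof -
    have "\<forall>x\<in>X. ev g x = ev f0 x" using that f0 by simp
    then show ?thesis using assms(1) unfolding banach_space_of_functions_def by blast
  qed
  have "element X ev h = f0"
    unfolding element_def using f0 unique by (rule the_equality)
  then show ?thesis using f0 unique by blast
qed

definition isometry_onto :: "('a::real_normed_vector \<Rightarrow> 'c::real_normed_vector) \<Rightarrow> 'c set \<Rightarrow> bool" where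
  "isometry_onto J S \<longleftrightarrow> linear J \<and> (\<forall>f. norm (J f) = norm f) \<and> range J = S"

definition point_evaluation :: "('b::banach \<Rightarrow> 'x \<Rightarrow> real) \<Rightarrow> 'x \<Rightarrow> 'b \<Rightarrow>\<^sub>L real" where
  "point_evaluation ev x = Blinfun (\<lambda>f. ev f x)"

definition delta_dual :: "'x set \<Rightarrow> ('b::banach \<Rightarrow> 'x \<Rightarrow> real) \<Rightarrow> ('b \<Rightarrow>\<^sub>L real) set" where
  "delta_dual X ev = closure (span (point_evaluation ev ` X))"

text \<open>
  The \<open>\<delta>\<close>-dual of the space \<open>(X, ev)\<close> is identified, through the isometry \<open>J\<close>, with the Banach
  space \<open>(X', ev')\<close> of functions on \<open>X'\<close>. Hence the dual pairing of \<open>g\<close> in the \<open>\<delta>\<close>-dual with \<open>f\<close>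
  is \<open>J g f\<close>.
\<close>

definition delta_dual_space ::
  "'x set \<Rightarrow> ('b::banach \<Rightarrow> 'x \<Rightarrow> real) \<Rightarrow> 'y set \<Rightarrow> ('c::banach \<Rightarrow> 'y \<Rightarrow> real)
     \<Rightarrow> ('c \<Rightarrow> 'b \<Rightarrow>\<^sub>L real) \<Rightarrow> bool" where
  "delta_dual_space X ev X' ev' J \<longleftrightarrow>
     banach_space_of_functions X' ev' \<and> isometry_onto J (delta_dual X ev)"

definition reproducing_kernel ::
  "'x set \<Rightarrow> ('b::banach \<Rightarrow> 'x \<Rightarrow> real) \<Rightarrow> 'y set \<Rightarrow> ('c::banach \<Rightarrow> 'y \<Rightarrow> real)
     \<Rightarrow> ('c \<Rightarrow> 'b \<Rightarrow>\<^sub>L real) \<Rightarrow> ('x \<Rightarrow> 'y \<Rightarrow> real) \<Rightarrow> bool" where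
  "reproducing_kernel X ev X' ev' J K \<longleftrightarrow>
     (\<forall>x\<in>X. belongs X' ev' (\<lambda>y. K x y) \<and>
            (\<forall>f. ev f x = J (element X' ev' (\<lambda>y. K x y)) f))"

definition kernel_section ::
  "'x set \<Rightarrow> ('b::banach \<Rightarrow> 'x \<Rightarrow> real) \<Rightarrow> ('x \<Rightarrow> 'y \<Rightarrow> real) \<Rightarrow> 'y \<Rightarrow> 'b" where
  "kernel_section X ev K y = element X ev (\<lambda>x. K x y)"

definition rkbs_pair ::
  "'x set \<Rightarrow> ('b::banach \<Rightarrow> 'x \<Rightarrow> real) \<Rightarrow> 'y set \<Rightarrow> ('c::banach \<Rightarrow> 'y \<Rightarrow> real)
     \<Rightarrow> ('c \<Rightarrow> 'b \<Rightarrow>\<^sub>L real) \<Rightarrow> ('x \<Rightarrow> 'y \<Rightarrow> real) \<Rightarrow> bool" where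
  "rkbs_pair X ev X' ev' J K \<longleftrightarrow>
     rkbs X ev \<and> delta_dual_space X ev X' ev' J \<and> reproducing_kernel X ev X' ev' J K \<and>
     rkbs X' ev' \<and>
     (\<forall>y\<in>X'. belongs X ev (\<lambda>x. K x y) \<and> (\<forall>g. ev' g y = J g (kernel_section X ev K y)))"

text \<open>
  The space \<open>'p\<close> is a pre-dual of \<open>'b\<close> through the isometry \<open>\<Phi>\<close>; the pairing of \<open>\<mu>\<close> in \<open>'p\<close> with
  \<open>f\<close> in \<open>'b\<close> is \<open>\<Phi> f \<mu>\<close>.
\<close>

definition predual :: "('b::banach \<Rightarrow> 'p::banach \<Rightarrow>\<^sub>L real) \<Rightarrow> bool" where
  "predual \<Phi> \<longleftrightarrow> isometry_onto \<Phi> UNIV"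

definition subdifferential ::
  "('p::real_normed_vector \<Rightarrow> real) \<Rightarrow> 'p \<Rightarrow> ('p \<Rightarrow>\<^sub>L real) set" where
  "subdifferential F \<mu> = {u. \<forall>\<omega>. F \<omega> - F \<mu> \<ge> blinfun_apply u (\<omega> - \<mu>)}"

definition norm_subdifferential ::
  "('b::banach \<Rightarrow> 'p::banach \<Rightarrow>\<^sub>L real) \<Rightarrow> 'p \<Rightarrow> 'b set" where
  "norm_subdifferential \<Phi> \<mu> = {f. \<Phi> f \<in> subdifferential norm \<mu>}"

definition lower_semicontinuous_on :: "'a::topological_space set \<Rightarrow> ('a \<Rightarrow> real) \<Rightarrow> bool" where
  "lower_semicontinuous_on S F \<longleftrightarrow>
     (\<forall>x\<in>S. \<forall>c < F x. eventually (\<lambda>y. c < F y) (at x within S))"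

definition data_map ::
  "('b::banach \<Rightarrow> 'p::banach \<Rightarrow>\<^sub>L real) \<Rightarrow> ('n::finite \<Rightarrow> 'p) \<Rightarrow> 'b \<Rightarrow> real ^ 'n" where
  "data_map \<Phi> \<nu> f = (\<chi> i. \<Phi> f (\<nu> i))"

definition regularized_solutions ::
  "('b::banach \<Rightarrow> 'p::banach \<Rightarrow>\<^sub>L real) \<Rightarrow> ('n::finite \<Rightarrow> 'p) \<Rightarrow> (real ^ 'n \<Rightarrow> real)
     \<Rightarrow> real \<Rightarrow> (real \<Rightarrow> real) \<Rightarrow> 'b set" where
  "regularized_solutions \<Phi> \<nu> Q lam \<phi> =
     {f. is_arg_min (\<lambda>g. Q (data_map \<Phi> \<nu> g) + lam * \<phi> (norm g)) (\<lambda>_. True) f}"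

text \<open>
  The number of columns of the matrix of a nonzero \<open>\<mu>\<close> depends on \<open>\<mu>\<close>, so it cannot be a type.
  Its columns are indexed directly by the finite set \<open>T\<close> of nodes instead of an enumeration of it,
  and its rank is the dimension of the span of its columns.
\<close>

definition matrix_rank :: "('n::finite \<Rightarrow> 'y \<Rightarrow> real) \<Rightarrow> 'y set \<Rightarrow> nat" where
  "matrix_rank A T = dim ((\<lambda>t. (\<chi> i. A i t) :: real ^ 'n) ` T)"

lemma matrix_rank_UNIV: "matrix_rank (\<lambda>i j. A $ i $ j) UNIV = rank (A :: real ^ 'm ^ 'n)"
  by (simp add: matrix_rank_def column_rank_def columns_def column_def image_def)

definition node_matrix ::
  "('b::banach \<Rightarrow> 'p::banach \<Rightarrow>\<^sub>L real) \<Rightarrow> ('n::finite \<Rightarrow> 'p) \<Rightarrow> ('y \<Rightarrow> 'b)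
     \<Rightarrow> 'n \<Rightarrow> 'y \<Rightarrow> real" where
  "node_matrix \<Phi> \<nu> k i t = \<Phi> (k t) (\<nu> i)"

text \<open>In the next three definitions \<open>k y\<close> is the kernel section at \<open>y\<close>, and \<open>N \<mu>\<close> is the finite
  set of nodes attached to \<open>\<mu>\<close>.\<close>

definition extreme_kernel_assumption ::
  "('b::banach \<Rightarrow> 'p::banach \<Rightarrow>\<^sub>L real) \<Rightarrow> 'p set \<Rightarrow> 'y set \<Rightarrow> ('y \<Rightarrow> 'b) \<Rightarrow> ('p \<Rightarrow> 'y set) \<Rightarrow> bool" where
  "extreme_kernel_assumption \<Phi> V X' k N \<longleftrightarrow>
     (\<forall>\<mu>\<in>V. \<mu> \<noteq> 0 \<longrightarrow>
        finite (N \<mu>) \<and> N \<mu> \<subseteq> X' \<and>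
        {f. f extreme_point_of norm_subdifferential \<Phi> \<mu>} \<subseteq> (\<Union>y\<in>N \<mu>. {- k y, k y}))"

definition l1_kernel_assumption :: "'y set \<Rightarrow> ('y \<Rightarrow> 'b::banach) \<Rightarrow> real \<Rightarrow> bool" where
  "l1_kernel_assumption X' k C \<longleftrightarrow>
     (\<forall>(m::nat) (x :: nat \<Rightarrow> 'y) (\<alpha> :: nat \<Rightarrow> real).
        x ` {1..m} \<subseteq> X' \<and> inj_on x {1..m} \<longrightarrow>
        norm (\<Sum>j=1..m. \<alpha> j *\<^sub>R k (x j)) = C * (\<Sum>j=1..m. \<bar>\<alpha> j\<bar>))"

definition sparse_kernel_form ::
  "('b::banach \<Rightarrow> 'p::banach \<Rightarrow>\<^sub>L real) \<Rightarrow> ('n::finite \<Rightarrow> 'p) \<Rightarrow> ('y \<Rightarrow> 'b) \<Rightarrow> ('p \<Rightarrow> 'y set)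
     \<Rightarrow> real \<Rightarrow> 'b \<Rightarrow> bool" where
  "sparse_kernel_form \<Phi> \<nu> k N C f \<longleftrightarrow>
     (\<exists>\<mu> \<in> span (range \<nu>). \<mu> \<noteq> 0 \<and>
        (\<exists>(M::nat) (x :: nat \<Rightarrow> 'y) (\<alpha> :: nat \<Rightarrow> real).
           0 < M \<and> M \<le> matrix_rank (node_matrix \<Phi> \<nu> k) (N \<mu>) \<and>
           (\<forall>j\<in>{1..M}. x j \<in> N \<mu> \<and> \<alpha> j \<noteq> 0) \<and>
           f = (\<Sum>j=1..M. \<alpha> j *\<^sub>R k (x j)) \<and>
           (\<Sum>j=1..M. \<bar>\<alpha> j\<bar>) = norm \<mu> / C))"

end

theory Submission
  imports Defs
begin

text \<open>
  Write \<open>L\<close> for the data map. The regularizer sees \<open>f\<close> only through \<open>L f\<close> and \<open>norm f\<close>, and it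
  does not increase when \<open>f\<close> is replaced by an element of minimal norm with the same data. So both
  claims are about minimum norm interpolation, that is, about the set \<open>M z\<close> of the elements of
  least norm with \<open>L f = z\<close>, for a nonzero \<open>z\<close>.

  \<^bold>\<open>From interpolation to the subdifferential.\<close> The data \<open>z\<close> define a linear functional on the finite
  dimensional space \<open>V = span (range \<nu>)\<close>. By the Hahn-Banach theorem the least norm of an
  interpolant is the norm \<open>r > 0\<close> of that functional on \<open>V\<close>, and by compactness the functional
  attains its norm at some \<open>\<mu> \<in> V\<close>, which is scaled so that \<open>norm \<mu> = r\<close>. Every \<open>f \<in> M z\<close> then
  satisfies \<open>f /\<^sub>R r \<in> norm_subdifferential \<Phi> \<mu>\<close> (lemma \<open>minimum_norm_interpolation\<close>).

  \<^bold>\<open>From the subdifferential to kernel sections.\<close> Every element of the predual, as a function on the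
  subdifferential, attains its maximum at an extreme point. Hence if it vanishes on the extreme
  points, it vanishes on the whole subdifferential. There are only finitely many extreme points, and
  for finitely many functionals vanishing on the common kernel means lying in the span. So every
  \<open>f \<in> M z\<close> is a combination of the kernel sections at the nodes of \<open>\<mu>\<close> (\<open>kernel_expansion\<close>). The
  full convex hull statement of the Krein-Milman theorem is replaced by this linear one because the
  \<open>\<ell>\<^sup>1\<close> identity of the kernel already recovers the size of the coefficients from \<open>norm f = r\<close>.

  \<^bold>\<open>Few nodes.\<close> Suppose that in such an expansion of \<open>f \<in> M z\<close> the columns \<open>L (k t)\<close> of the nodes
  in use are linearly dependent. A relation between them gives a nonzero direction \<open>h\<close> with
  \<open>L h = 0\<close>. Along \<open>f + s *\<^sub>R h\<close> the \<open>\<ell>\<^sup>1\<close> norm of the coefficients is affine in \<open>s\<close> until one of them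
  vanishes; as the norm is minimal at \<open>s = 0\<close>, it is constant there. So \<open>f + h\<close> and \<open>f - h\<close> lie in
  \<open>M z\<close> after scaling \<open>h\<close>, and \<open>f + h\<close> uses fewer nodes (\<open>minimum_norm_expansion_exchange\<close>). An
  expansion with the fewest nodes, and the expansion of an extreme point, therefore have independent
  columns, and their number is at most the rank of the node matrix.

  Existence of a regularized solution is the minimization of \<open>Q z + lam * \<phi> \<rho>\<close> over the pairs
  \<open>(z, \<rho>)\<close> for which some element of norm at most \<open>\<rho>\<close> has data \<open>z\<close>; these pairs form a closed
  set in a finite dimensional space.

  The Hahn-Banach theorem and the existence of extreme points both come from one application of
  Zorn's lemma to sublinear functionals, which avoids the weak* topology.
\<close>

section \<open>Extreme linear functionals below a sublinear functional\<close>

definition sublinear :: "('a::real_vector \<Rightarrow> real) \<Rightarrow> bool" where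
  "sublinear p \<longleftrightarrow> (\<forall>x y. p (x + y) \<le> p x + p y) \<and> (\<forall>t\<ge>0. \<forall>x. p (t *\<^sub>R x) = t * p x)"

text \<open>The directional derivative of \<open>p\<close> at \<open>x\<close> in the direction \<open>y\<close>: with \<open>t = 1 / h\<close> the quotient
\<open>(p (x + h *\<^sub>R y) - p x) / h\<close> is \<open>p (y + t *\<^sub>R x) - t * p x\<close>, and by convexity the limit as \<open>h\<close>
decreases to \<open>0\<close> is an infimum.\<close>

definition tangent :: "('a::real_vector \<Rightarrow> real) \<Rightarrow> 'a \<Rightarrow> 'a \<Rightarrow> real" where
  "tangent p x y = (INF t\<in>{0..}. p (y + t *\<^sub>R x) - t * p x)"

lemma sublinearD:
  assumes "sublinear p"
  shows "p (x + y) \<le> p x + p y" and "t \<ge> 0 \<Longrightarrow> p (t *\<^sub>R x) = t * p x"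
    and "p 0 = 0" and "- p (- x) \<le> p x"
proof -
  show 1: "p (x + y) \<le> p x + p y" for x y
    using assms by (simp add: sublinear_def)
  show 2: "t \<ge> 0 \<Longrightarrow> p (t *\<^sub>R x) = t * p x" for t x
    using assms by (simp add: sublinear_def)
  show 3: "p 0 = 0" using 2[of 0 0] by simp
  show "- p (- x) \<le> p x" using 1[of x "- x"] 3 by simp
qed

lemma sublinearI:
  assumes add: "\<And>x y. p (x + y) \<le> p x + p y" and zero: "p 0 = 0"
    and le: "\<And>t x. t > 0 \<Longrightarrow> p (t *\<^sub>R x) \<le> t * p x"
  shows "sublinear p"
proof -
  have "p (t *\<^sub>R x) = t * p x" if "t \<ge> 0" for t x
  proof (cases "t = 0")
    case False
    then have t: "t > 0" using that by simp
    have "p ((1 / t) *\<^sub>R (t *\<^sub>R x)) \<le> (1 / t) * p (t *\<^sub>R x)" using t by (intro le) simp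
    then have "t * p x \<le> p (t *\<^sub>R x)" using t by (simp add: field_simps)
    then show ?thesis using le[OF t] by (rule antisym[rotated])
  qed (simp add: zero)
  then show ?thesis using add by (simp add: sublinear_def)
qed

lemma sublinear_norm: "sublinear (norm :: 'a::real_normed_vector \<Rightarrow> real)"
  by (simp add: sublinear_def norm_triangle_ineq)

lemma tangent_lower:
  assumes "sublinear p" "t \<ge> 0"
  shows "- p (- y) \<le> p (y + t *\<^sub>R x) - t * p x"
proof -
  have "t * p x = p ((y + t *\<^sub>R x) + (- y))"
    using sublinearD(2)[OF assms] by simp
  also have "\<dots> \<le> p (y + t *\<^sub>R x) + p (- y)"
    by (rule sublinearD(1)[OF assms(1)])
  finally show ?thesis by simp
qed

lemma tangent_le:
  assumes "sublinear p" "t \<ge> 0"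
  shows "tangent p x y \<le> p (y + t *\<^sub>R x) - t * p x"
  unfolding tangent_def
proof (rule cINF_lower)
  show "bdd_below ((\<lambda>t. p (y + t *\<^sub>R x) - t * p x) ` {0..})"
    by (rule bdd_belowI2[of _ "- p (- y)"]) (use tangent_lower[OF assms(1)] in auto)
qed (use assms in auto)

lemma tangent_greatest:
  assumes "\<And>t. t \<ge> 0 \<Longrightarrow> m \<le> p (y + t *\<^sub>R x) - t * p x"
  shows "m \<le> tangent p x y"
  unfolding tangent_def by (rule cINF_greatest) (use assms in auto)

lemma sublinear_tangent:
  assumes p: "sublinear p"
  shows "sublinear (tangent p x)"
proof -
  have add: "tangent p x (y + z) \<le> tangent p x y + tangent p x z" for y z
  proof -
    have "tangent p x (y + z) - (p (z + s *\<^sub>R x) - s * p x) \<le> p (y + t *\<^sub>R x) - t * p x"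
      if "s \<ge> 0" "t \<ge> 0" for s t
    proof -
      have "tangent p x (y + z) \<le> p ((y + z) + (t + s) *\<^sub>R x) - (t + s) * p x"
        using tangent_le[OF p, of "t + s"] that by simp
      also have "p ((y + z) + (t + s) *\<^sub>R x) \<le> p (y + t *\<^sub>R x) + p (z + s *\<^sub>R x)"
        using sublinearD(1)[OF p, of "y + t *\<^sub>R x" "z + s *\<^sub>R x"]
        by (simp add: algebra_simps)
      finally show ?thesis by (simp add: algebra_simps)
    qed
    then have "tangent p x (y + z) - (p (z + s *\<^sub>R x) - s * p x) \<le> tangent p x y" if "s \<ge> 0" for s
      using that by (intro tangent_greatest) auto
    then have "tangent p x (y + z) - tangent p x y \<le> tangent p x z"
      by (intro tangent_greatest) (simp add: algebra_simps)
    then show ?thesis by simp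
  qed
  have le: "tangent p x (t *\<^sub>R y) \<le> t * tangent p x y" if "t > 0" for t y
  proof -
    have "tangent p x (t *\<^sub>R y) / t \<le> tangent p x y"
    proof (rule tangent_greatest)
      fix s :: real assume "s \<ge> 0"
      then have "tangent p x (t *\<^sub>R y) \<le> p (t *\<^sub>R y + (t * s) *\<^sub>R x) - (t * s) * p x"
        using that by (intro tangent_le[OF p]) simp
      also have "\<dots> = t * (p (y + s *\<^sub>R x) - s * p x)"
        using sublinearD(2)[OF p, of t "y + s *\<^sub>R x"] that by (simp add: algebra_simps)
      finally show "tangent p x (t *\<^sub>R y) / t \<le> p (y + s *\<^sub>R x) - s * p x"
        using that by (simp add: field_simps)
    qed
    then show ?thesis using that by (simp add: field_simps)
  qed
  have zero: "tangent p x 0 = 0"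
  proof (rule antisym)
    show "tangent p x 0 \<le> 0"
      using tangent_le[OF p, of 0 x 0] by (simp add: sublinearD(3)[OF p])
    show "0 \<le> tangent p x 0"
      using tangent_lower[OF p, of _ 0 x] by (intro tangent_greatest) (simp add: sublinearD(3)[OF p])
  qed
  show ?thesis by (rule sublinearI[OF add zero le])
qed

lemma tangent_self: "sublinear p \<Longrightarrow> tangent p x y \<le> p y"
  using tangent_le[of p 0 x y] by simp

lemma tangent_minus:
  assumes "sublinear p" shows "tangent p x (- x) \<le> - p x"
  using tangent_le[OF assms, of 1 x "- x"] sublinearD(3)[OF assms] by simp

text \<open>Passing from \<open>p\<close> to its tangent at \<open>x\<close> cuts out, among the linear functionals below \<open>p\<close>, the face
on which the evaluation at \<open>x\<close> is maximal. For \<open>p = norm\<close> this face is the subdifferential of the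
norm at \<open>x\<close>.\<close>

lemma linear_below_tangent_iff:
  assumes p: "sublinear p" and u: "linear u"
  shows "(\<forall>y. u y \<le> tangent p x y) \<longleftrightarrow> (\<forall>y. u y \<le> p y) \<and> u x = p x"
proof (intro iffI conjI allI)
  assume *: "\<forall>y. u y \<le> tangent p x y"
  show le: "u y \<le> p y" for y
    using * tangent_self[OF p] order_trans by blast
  have "u (- x) \<le> - p x"
    using * tangent_minus[OF p] order_trans by blast
  then show "u x = p x" using le[of x] linear_neg[OF u, of x] by simp
next
  fix y assume *: "(\<forall>y. u y \<le> p y) \<and> u x = p x"
  show "u y \<le> tangent p x y"
  proof (rule tangent_greatest)
    fix t :: real
    have "u y = u (y + t *\<^sub>R x) - t * u x"
      by (simp add: linear_add[OF u] linear_cmul[OF u])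
    also have "\<dots> \<le> p (y + t *\<^sub>R x) - t * p x" using * by simp
    finally show "u y \<le> p (y + t *\<^sub>R x) - t * p x" .
  qed
qed

text \<open>The linear functionals below \<open>q\<close> form a face of the convex set of the linear functionals below \<open>p\<close>.
Sublinear functionals thus stand in for the weak* closed faces, with the pointwise order for
inclusion.\<close>

definition face_below :: "('a::real_vector \<Rightarrow> real) \<Rightarrow> ('a \<Rightarrow> real) \<Rightarrow> bool" where
  "face_below p q \<longleftrightarrow> sublinear q \<and> q \<le> p \<and>
     (\<forall>a b t. linear a \<and> linear b \<and> a \<le> p \<and> b \<le> p \<and> 0 < t \<and> t < 1 \<and>
        (\<lambda>y. (1 - t) * a y + t * b y) \<le> q \<longrightarrow> a \<le> q \<and> b \<le> q)"

lemma face_below_tangent: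
  assumes pq: "face_below p q"
  shows "face_below p (tangent q x)"
proof -
  have q: "sublinear q" and qp: "q \<le> p" using pq by (auto simp: face_below_def)
  have tq: "tangent q x \<le> q" by (simp add: le_fun_def tangent_self[OF q])
  have "a \<le> tangent q x \<and> b \<le> tangent q x"
    if ab: "linear a" "linear b" "a \<le> p" "b \<le> p" and t: "0 < t" "t < 1"
      and le: "(\<lambda>y. (1 - t) * a y + t * b y) \<le> tangent q x" for a b t
  proof -
    have "a \<le> q \<and> b \<le> q"
      using pq ab t order_trans[OF le tq] unfolding face_below_def by blast
    then have aq: "\<And>y. a y \<le> q y" and bq: "\<And>y. b y \<le> q y" by (auto simp: le_fun_def)
    have lin: "linear (\<lambda>y. (1 - t) * a y + t * b y)"
      using ab(1,2) by (auto simp: linear_iff algebra_simps)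
    have "(1 - t) * a x + t * b x = q x"
      using linear_below_tangent_iff[OF q lin] le by (auto simp: le_fun_def)
    \<comment> \<open>A mixture attains the maximum \<open>q x\<close> at \<open>x\<close> only if both of its parts do.\<close>
    then have eq: "(1 - t) * (q x - a x) + t * (q x - b x) = 0" by (simp add: algebra_simps)
    have "(1 - t) * (q x - a x) \<ge> 0" "t * (q x - b x) \<ge> 0" using t aq[of x] bq[of x] by simp_all
    with eq have "(1 - t) * (q x - a x) = 0" "t * (q x - b x) = 0" by linarith+
    then have "a x = q x" "b x = q x" using t by auto
    then show ?thesis
      using linear_below_tangent_iff[OF q ab(1), of x] linear_below_tangent_iff[OF q ab(2), of x] aq bq
      by (auto simp: le_fun_def)
  qed
  moreover have "tangent q x \<le> p" using tq qp by (rule order_trans)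
  ultimately show ?thesis unfolding face_below_def using sublinear_tangent[OF q] by blast
qed

text \<open>The pointwise infimum works: it is subadditive because any two members of a chain have a common
lower bound in it, and it is finite because every sublinear \<open>q \<le> p\<close> satisfies
\<open>q x \<ge> - p (- x)\<close>.\<close>

lemma face_below_chain:
  assumes ne: "\<C> \<noteq> {}" and chain: "\<And>q r. q \<in> \<C> \<Longrightarrow> r \<in> \<C> \<Longrightarrow> q \<le> r \<or> r \<le> q"
    and face: "\<And>q. q \<in> \<C> \<Longrightarrow> face_below p q"
  shows "\<exists>m. face_below p m \<and> (\<forall>q\<in>\<C>. m \<le> q)"
proof -
  define m where "m = (\<lambda>x. INF q\<in>\<C>. q x)"
  have sub: "sublinear q" and qp: "q \<le> p" if "q \<in> \<C>" for q
    using face[OF that] by (auto simp: face_below_def)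
  have bdd: "bdd_below ((\<lambda>q. q x) ` \<C>)" for x
  proof (rule bdd_belowI2[of _ "- p (- x)"])
    fix q assume "q \<in> \<C>"
    then show "- p (- x) \<le> q x"
      using sublinearD(4)[OF sub, of q x] qp[of q] by (smt (verit) le_fun_def)
  qed
  have lower: "m x \<le> q x" if "q \<in> \<C>" for q x
    unfolding m_def using bdd that by (rule cINF_lower)
  have greatest: "c \<le> m x" if "\<And>q. q \<in> \<C> \<Longrightarrow> c \<le> q x" for c x
    unfolding m_def using ne that by (rule cINF_greatest)
  have add: "m (x + y) \<le> m x + m y" for x y
  proof -
    have "m (x + y) - r y \<le> q x" if qr: "q \<in> \<C>" "r \<in> \<C>" for q r
    proof -
      \<comment> \<open>The smaller one of \<open>q\<close> and \<open>r\<close>, to which subadditivity applies.\<close>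
      obtain s where s: "s \<in> \<C>" "s \<le> q" "s \<le> r"
        using chain[OF qr] qr by blast
      have "m (x + y) \<le> s x + s y"
        using lower[OF s(1), of "x + y"] sublinearD(1)[OF sub[OF s(1)], of x y] by linarith
      also have "\<dots> \<le> q x + r y" using s(2,3) by (intro add_mono) (auto simp: le_fun_def)
      finally show ?thesis by simp
    qed
    then have "m (x + y) - r y \<le> m x" if "r \<in> \<C>" for r
      using that by (intro greatest) auto
    then have "m (x + y) - m x \<le> m y"
      by (intro greatest) (simp add: algebra_simps)
    then show ?thesis by simp
  qed
  have le: "m (t *\<^sub>R x) \<le> t * m x" if "t > 0" for t x
  proof -
    have "m (t *\<^sub>R x) / t \<le> m x"
    proof (rule greatest)
      fix q assume q: "q \<in> \<C>"
      then show "m (t *\<^sub>R x) / t \<le> q x"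
        using lower[OF q, of "t *\<^sub>R x"] sublinearD(2)[OF sub[OF q], of t x] that
        by (simp add: field_simps)
    qed
    then show ?thesis using that by (simp add: field_simps)
  qed
  have zero: "m 0 = 0"
  proof (rule antisym)
    obtain q where q: "q \<in> \<C>" using ne by blast
    show "m 0 \<le> 0" using lower[OF q, of 0] sublinearD(3)[OF sub[OF q]] by simp
    show "0 \<le> m 0" by (rule greatest) (simp add: sublinearD(3)[OF sub])
  qed
  have "sublinear m" by (rule sublinearI[OF add zero le])
  moreover have "m \<le> p"
    using ne lower qp by (metis (no_types, lifting) ex_in_conv le_fun_def order_trans)
  moreover have "a \<le> m \<and> b \<le> m"
    if "linear a" "linear b" "a \<le> p" "b \<le> p" "0 < t" "t < 1"
      and le: "(\<lambda>y. (1 - t) * a y + t * b y) \<le> m" for a b t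
  proof -
    have "a \<le> q \<and> b \<le> q" if q: "q \<in> \<C>" for q
    proof -
      have "(\<lambda>y. (1 - t) * a y + t * b y) \<le> q"
        using le lower[OF q] order_trans unfolding le_fun_def by blast
      then show ?thesis using face[OF q] that \<open>linear a\<close> \<open>linear b\<close> \<open>a \<le> p\<close> \<open>b \<le> p\<close> \<open>0 < t\<close> \<open>t < 1\<close>
        unfolding face_below_def by blast
    qed
    then show ?thesis by (auto simp: le_fun_def intro!: greatest)
  qed
  ultimately have "face_below p m" unfolding face_below_def by blast
  then show ?thesis using lower by (auto simp: le_fun_def)
qed

text \<open>By Zorn's lemma there is a minimal \<open>u\<close> with \<open>face_below p u\<close>. Minimality forces \<open>u\<close> to equal all of
its tangents, and \<open>tangent u x (- x) \<le> - u x\<close> then makes \<open>u\<close> odd; an odd sublinear functional is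
linear.\<close>

lemma extreme_linear_below_sublinear:
  fixes p :: "'a::real_vector \<Rightarrow> real"
  assumes p: "sublinear p"
  shows "\<exists>u. linear u \<and> face_below p u"
proof -
  define A where "A = {q. face_below p q}"
  have pA: "p \<in> A" unfolding A_def face_below_def using p by auto
  have "\<exists>q\<in>A. \<forall>r\<in>A. r \<le> q \<longrightarrow> r = q"
  proof (rule predicate_Zorn[where P = "\<lambda>q r. r \<le> q"])
    show "partial_order_on A (relation_of (\<lambda>q r. r \<le> q) A)"
      by (rule partial_order_on_relation_ofI) auto
    fix \<C> assume C: "\<C> \<in> Chains (relation_of (\<lambda>q r. r \<le> q) A)"
    show "\<exists>u\<in>A. \<forall>a\<in>\<C>. u \<le> a"
    proof (cases "\<C> = {}")
      case True
      then show ?thesis using pA by auto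
    next
      case False
      have "q \<le> r \<or> r \<le> q" if "q \<in> \<C>" "r \<in> \<C>" for q r
        using C that by (auto simp: Chains_def relation_of_def)
      moreover have "face_below p q" if "q \<in> \<C>" for q
        using C that by (auto simp: Chains_def relation_of_def A_def)
      ultimately show ?thesis using face_below_chain[OF False] by (auto simp: A_def)
    qed
  qed
  then obtain u where u: "face_below p u" and min: "\<And>r. face_below p r \<Longrightarrow> r \<le> u \<Longrightarrow> r = u"
    by (auto simp: A_def)
  have sub: "sublinear u" using u by (simp add: face_below_def)
  have tan: "tangent u x = u" for x
    by (rule min[OF face_below_tangent[OF u]]) (simp add: le_fun_def tangent_self[OF sub])
  have odd: "u (- x) = - u x" for x
    using tangent_minus[OF sub, of x] tan[of x] sublinearD(4)[OF sub, of x] by simp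
  have "linear u"
  proof (rule linearI)
    fix x y
    have "u (- x + - y) \<le> u (- x) + u (- y)" by (rule sublinearD(1)[OF sub])
    then have "u x + u y \<le> u (x + y)"
      using odd[of x] odd[of y] odd[of "x + y"] by simp
    then show "u (x + y) = u x + u y" using sublinearD(1)[OF sub, of x y] by simp
  next
    fix t :: real and x
    show "u (t *\<^sub>R x) = t *\<^sub>R u x"
    proof (cases "t \<ge> 0")
      case True
      then show ?thesis using sublinearD(2)[OF sub] by simp
    next
      case False
      then show ?thesis using sublinearD(2)[OF sub, of "- t" x] odd[of "t *\<^sub>R x"] by simp
    qed
  qed
  then show ?thesis using u by blast
qed

lemma linear_le_imp_eq:
  fixes u v :: "'a::real_vector \<Rightarrow> real"
  assumes "linear u" "linear v" "u \<le> v"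
  shows "u = v"
proof
  fix x
  have "u x \<le> v x" "u (- x) \<le> v (- x)" using assms(3) by (auto simp: le_fun_def)
  then show "u x = v x" using linear_neg[OF assms(1), of x] linear_neg[OF assms(2), of x] by simp
qed

text \<open>Hahn-Banach and Krein-Milman in one statement: the evaluation at \<open>x\<close> attains its maximum over the
linear functionals below \<open>p\<close>, namely \<open>p x\<close>, at an extreme one. An extreme functional of the face
below \<open>tangent p x\<close> is extreme among all functionals below \<open>p\<close>.\<close>

lemma extreme_linear_below_sublinear_at:
  fixes p :: "'a::real_vector \<Rightarrow> real"
  assumes p: "sublinear p"
  obtains u where "linear u" "u \<le> p" "u x = p x"
    "\<And>a b t. \<lbrakk>linear a; linear b; a \<le> p; b \<le> p; 0 < t; t < 1; u = (\<lambda>y. (1 - t) * a y + t * b y)\<rbrakk>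
       \<Longrightarrow> a = u \<and> b = u"
proof -
  have st: "sublinear (tangent p x)" by (rule sublinear_tangent[OF p])
  have fp: "face_below p p" unfolding face_below_def using p by auto
  have ft: "face_below p (tangent p x)" by (rule face_below_tangent[OF fp])
  obtain u where lin: "linear u" and u: "face_below (tangent p x) u"
    using extreme_linear_below_sublinear[OF st] by blast
  have ut: "u \<le> tangent p x" using u by (simp add: face_below_def)
  then have up: "u \<le> p \<and> u x = p x"
    using linear_below_tangent_iff[OF p lin, of x] by (auto simp: le_fun_def)
  have "a = u \<and> b = u"
    if ab: "linear a" "linear b" "a \<le> p" "b \<le> p" "0 < t" "t < 1"
      and eq: "u = (\<lambda>y. (1 - t) * a y + t * b y)" for a b t
  proof -
    have "a \<le> tangent p x \<and> b \<le> tangent p x"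
      using ft ab ut[unfolded eq] unfolding face_below_def by blast
    then have "a \<le> u \<and> b \<le> u"
      using u ab order_refl[of u, unfolded eq] unfolding face_below_def eq by blast
    then show ?thesis using linear_le_imp_eq ab(1,2) lin by blast
  qed
  then show thesis using that lin up by blast
qed

lemma blinfun_of_linear_bounded:
  fixes u :: "'a::real_normed_vector \<Rightarrow> real"
  assumes lin: "linear u" and bd: "\<And>x. u x \<le> r * norm x" and "r \<ge> 0"
  obtains U where "blinfun_apply U = u" "norm U \<le> r"
proof -
  have bd2: "norm (u x) \<le> norm x * r" for x
    using bd[of x] bd[of "- x"] linear_neg[OF lin, of x] by (simp add: mult.commute abs_le_iff)
  have "bounded_linear u"
    using lin bd2 by (intro bounded_linear_intro[where K = r]) (auto simp: linear_add linear_cmul)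
  then have "blinfun_apply (Blinfun u) = u" by (rule bounded_linear_Blinfun_apply)
  moreover have "norm (Blinfun u) \<le> r"
    using norm_blinfun_bound[of r "Blinfun u"] assms(3) bd2 calculation by (simp add: mult.commute)
  ultimately show thesis by (rule that)
qed


section \<open>Norm-preserving extension and norming combinations\<close>

definition combination :: "('n::finite \<Rightarrow> 'p::real_vector) \<Rightarrow> real ^ 'n \<Rightarrow> 'p" where
  "combination \<nu> c = (\<Sum>i\<in>UNIV. (c $ i) *\<^sub>R \<nu> i)"

lemma linear_combination_map: "linear (combination \<nu>)"
  by (rule linearI) (simp_all add: combination_def scaleR_left_distrib sum.distrib scaleR_sum_right)

lemma combination_in_span: "combination \<nu> c \<in> span (range \<nu>)"
  unfolding combination_def by (intro span_sum span_scale span_base) auto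

lemma combination_axis: "combination \<nu> (axis i 1) = \<nu> i"
proof -
  have "combination \<nu> (axis i 1) = (\<Sum>j\<in>UNIV. if j = i then \<nu> j else 0)"
    unfolding combination_def by (intro sum.cong) (auto simp: axis_def)
  then show ?thesis by simp
qed

text \<open>Injectivity of the family is needed in addition to independence of its range, since a repeated
vector gives a nontrivial relation between the indices.\<close>

lemma combination_eq_0:
  assumes "inj \<nu>" "independent (range \<nu>)" "combination \<nu> c = 0"
  shows "c = 0"
proof -
  have "(\<Sum>v\<in>range \<nu>. (c $ inv \<nu> v) *\<^sub>R v) = 0"
    using assms(1,3) by (simp add: sum.reindex combination_def)
  then have "c $ inv \<nu> (\<nu> i) = 0" for i
    using assms(2) by (intro independentD[of "range \<nu>" "range \<nu>" "\<lambda>v. c $ inv \<nu> v"]) auto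
  then show ?thesis using assms(1) by (simp add: vec_eq_iff)
qed

lemma blinfun_combination:
  fixes U :: "'p::real_normed_vector \<Rightarrow>\<^sub>L real"
  assumes "\<And>i. U (\<nu> i) = z $ i"
  shows "U (combination \<nu> c) = z \<bullet> c"
  by (simp add: combination_def blinfun.sum_right blinfun.scaleR_right assms inner_vec_def mult.commute)

lemma norm_combination_le: "norm (combination \<nu> c) \<le> norm c * (\<Sum>i\<in>UNIV. norm (\<nu> i))"
proof -
  have "norm (combination \<nu> c) \<le> (\<Sum>i\<in>UNIV. norm ((c $ i) *\<^sub>R \<nu> i))"
    unfolding combination_def by (rule norm_sum)
  also have "\<dots> \<le> (\<Sum>i\<in>UNIV. norm c * norm (\<nu> i))"
    by (intro sum_mono) (simp add: mult_right_mono component_le_norm_cart)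
  finally show ?thesis by (simp add: sum_distrib_left)
qed

lemma bounded_linear_combination: "bounded_linear (combination \<nu>)"
  using linear_combination_map[of \<nu>] norm_combination_le[of \<nu>]
  by (intro bounded_linear_intro[where K = "\<Sum>i\<in>UNIV. norm (\<nu> i)"])
    (auto simp: linear_add linear_cmul)

text \<open>Helly's theorem. The values prescribed on \<open>\<nu>\<close> and the norm bound are encoded together in the
sublinear functional \<open>p x = (INF c. z \<bullet> c + r * norm (x - combination \<nu> c))\<close>. A linear functional
below it is bounded by \<open>r * norm x\<close> (take \<open>c = 0\<close>) and by \<open>z \<bullet> c\<close> at \<open>combination \<nu> c\<close>, and in the
second bound equality follows by changing the sign of \<open>c\<close>.\<close>

lemma functional_with_prescribed_values:
  fixes \<nu> :: "'n::finite \<Rightarrow> 'p::real_normed_vector"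
  assumes r: "r \<ge> 0" and bd: "\<And>c. z \<bullet> c \<le> r * norm (combination \<nu> c)"
  obtains U :: "'p \<Rightarrow>\<^sub>L real" where "norm U \<le> r" "\<And>i. U (\<nu> i) = z $ i"
proof -
  define p where "p x = (INF c. z \<bullet> c + r * norm (x - combination \<nu> c))" for x
  note lin = linear_combination_map[of \<nu>]
  have low: "- r * norm x \<le> z \<bullet> c + r * norm (x - combination \<nu> c)" for x c
  proof -
    have "- (z \<bullet> c) \<le> r * norm (combination \<nu> c)"
      using bd[of "- c"] by (simp add: linear_neg[OF lin])
    also have "\<dots> \<le> r * (norm x + norm (x - combination \<nu> c))"
      using norm_triangle_ineq4[of x "x - combination \<nu> c"] by (intro mult_left_mono r) simp
    finally show ?thesis by (simp add: algebra_simps)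
  qed
  have le: "p x \<le> z \<bullet> c + r * norm (x - combination \<nu> c)" for x c
    unfolding p_def by (intro cINF_lower bdd_belowI2[of _ "- r * norm x"] low) auto
  have greatest: "m \<le> p x" if "\<And>c. m \<le> z \<bullet> c + r * norm (x - combination \<nu> c)" for m x
    unfolding p_def by (intro cINF_greatest that) auto
  have "sublinear p"
  proof (rule sublinearI)
    fix x y
    have "p (x + y) - (z \<bullet> d + r * norm (y - combination \<nu> d))
            \<le> z \<bullet> c + r * norm (x - combination \<nu> c)" for c d
    proof -
      have "p (x + y) \<le> z \<bullet> (c + d) + r * norm ((x + y) - combination \<nu> (c + d))" by (rule le)
      also have "norm ((x + y) - combination \<nu> (c + d))
          \<le> norm (x - combination \<nu> c) + norm (y - combination \<nu> d)"
        using norm_triangle_ineq[of "x - combination \<nu> c" "y - combination \<nu> d"]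
        by (simp add: linear_add[OF lin] algebra_simps)
      finally show ?thesis using r by (simp add: mult_right_mono algebra_simps)
    qed
    then have "p (x + y) - (z \<bullet> d + r * norm (y - combination \<nu> d)) \<le> p x" for d
      by (rule greatest)
    then have "p (x + y) - p x \<le> p y" by (intro greatest) (simp add: algebra_simps)
    then show "p (x + y) \<le> p x + p y" by simp
  next
    show "p 0 = 0"
    proof (rule antisym)
      show "p 0 \<le> 0" using le[of 0 0] by (simp add: linear_0[OF lin])
      show "0 \<le> p 0" using low[of 0] by (intro greatest) simp
    qed
  next
    fix t :: real and x assume t: "t > 0"
    have "p (t *\<^sub>R x) / t \<le> p x"
    proof (rule greatest)
      fix c
      have "p (t *\<^sub>R x) \<le> z \<bullet> (t *\<^sub>R c) + r * norm (t *\<^sub>R x - combination \<nu> (t *\<^sub>R c))" by (rule le)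
      also have "norm (t *\<^sub>R x - combination \<nu> (t *\<^sub>R c)) = t * norm (x - combination \<nu> c)"
        using t by (simp add: linear_cmul[OF lin] flip: scaleR_diff_right)
      finally show "p (t *\<^sub>R x) / t \<le> z \<bullet> c + r * norm (x - combination \<nu> c)"
        using t by (simp add: field_simps)
    qed
    then show "p (t *\<^sub>R x) \<le> t * p x" using t by (simp add: field_simps)
  qed
  then obtain u where u: "linear u" "u \<le> p"
    by (rule extreme_linear_below_sublinear_at)
  have up: "u x \<le> p x" for x using u(2) by (simp add: le_fun_def)
  have "u x \<le> r * norm x" for x
    using up[of x] le[of x 0] by (simp add: linear_0[OF lin])
  with u(1) obtain U where U: "blinfun_apply U = u" "norm U \<le> r"
    using r by (rule blinfun_of_linear_bounded)
  have upper: "u (combination \<nu> c) \<le> z \<bullet> c" for c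
    using up[of "combination \<nu> c"] le[of "combination \<nu> c" c] by simp
  have "U (\<nu> i) = z $ i" for i
    using upper[of "axis i 1"] upper[of "- axis i 1"]
    by (simp add: U(1) linear_neg[OF lin] linear_neg[OF u(1)] combination_axis inner_axis)
  with U(2) show thesis by (rule that)
qed

text \<open>The functional \<open>combination \<nu> c \<mapsto> z \<bullet> c\<close> on the finite dimensional span attains its norm \<open>r\<close>:
the quotient is continuous on the unit sphere of the coefficients, as independence keeps the
denominator away from \<open>0\<close>, and it is homogeneous of degree \<open>0\<close>.\<close>

lemma norming_combination:
  fixes \<nu> :: "'n::finite \<Rightarrow> 'p::real_normed_vector"
  assumes inj: "inj \<nu>" and ind: "independent (range \<nu>)" and z: "z \<noteq> 0"
  obtains c r where "r > 0" "combination \<nu> c \<noteq> 0" "z \<bullet> c = r * norm (combination \<nu> c)"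
    "\<And>d. z \<bullet> d \<le> r * norm (combination \<nu> d)"
proof -
  define g where "g c = (z \<bullet> c) / norm (combination \<nu> c)" for c
  note lin = linear_combination_map[of \<nu>]
  have ne: "combination \<nu> c \<noteq> 0" if "c \<noteq> 0" for c
    using combination_eq_0[OF inj ind] that by blast
  have cont: "continuous_on (sphere 0 1) g"
    unfolding g_def
  proof (intro continuous_intros)
    show "continuous_on (sphere 0 1) (combination \<nu>)"
      by (rule linear_continuous_on[OF bounded_linear_combination])
    show "\<forall>c\<in>sphere 0 1. norm (combination \<nu> c) \<noteq> 0"
      using ne by (metis mem_sphere_0 norm_eq_zero zero_neq_one)
  qed
  have zs: "z /\<^sub>R norm z \<in> sphere 0 1" using z by simp
  then obtain c where c: "c \<in> sphere 0 1" and max: "\<And>d. d \<in> sphere 0 1 \<Longrightarrow> g d \<le> g c"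
    using continuous_attains_sup[OF compact_sphere _ cont] by blast
  have c0: "c \<noteq> 0" using c by auto
  have "0 < g (z /\<^sub>R norm z)"
    unfolding g_def using z ne[of "z /\<^sub>R norm z"] by (simp add: divide_pos_pos)
  then have "g c > 0" using max[OF zs] by linarith
  moreover have "z \<bullet> c = g c * norm (combination \<nu> c)" using ne[OF c0] by (simp add: g_def)
  moreover have "z \<bullet> d \<le> g c * norm (combination \<nu> d)" for d
  proof (cases "d = 0")
    case False
    have "g (d /\<^sub>R norm d) = g d"
      unfolding g_def using False by (simp add: linear_cmul[OF lin])
    then have "g d \<le> g c" using max[of "d /\<^sub>R norm d"] False by simp
    then show ?thesis using ne[OF False] by (simp add: g_def field_simps)
  qed (simp add: linear_0[OF lin])
  ultimately show thesis using that ne[OF c0] by blast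
qed

section \<open>Extreme points of norm subdifferentials span them\<close>

lemma predual_surj:
  assumes "predual \<Phi>" obtains f where "\<Phi> f = U"
  using assms unfolding predual_def isometry_onto_def by (metis surj_def)

lemma predual_linear: "predual \<Phi> \<Longrightarrow> linear \<Phi>"
  by (simp add: predual_def isometry_onto_def)

lemma predual_norm: "predual \<Phi> \<Longrightarrow> norm (\<Phi> f) = norm f"
  by (simp add: predual_def isometry_onto_def)

lemma predual_inj: 
  assumes "predual \<Phi>" shows "inj \<Phi>"
proof (rule injI)
  fix f g assume "\<Phi> f = \<Phi> g"
  then have "norm (\<Phi> (f - g)) = 0" by (simp add: linear_diff[OF predual_linear[OF assms]])
  then show "f = g" by (simp add: predual_norm[OF assms])
qed

lemma in_norm_subdifferential_iff:
  "f \<in> norm_subdifferential \<Phi> \<mu> \<longleftrightarrow> (\<forall>x. \<Phi> f x \<le> norm x) \<and> \<Phi> f \<mu> = norm \<mu>"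
proof
  assume "f \<in> norm_subdifferential \<Phi> \<mu>"
  then have *: "\<Phi> f x - \<Phi> f \<mu> \<le> norm x - norm \<mu>" for x
    by (simp add: norm_subdifferential_def subdifferential_def blinfun.diff_right)
  have "\<Phi> f \<mu> = norm \<mu>"
    using *[of 0] *[of "2 *\<^sub>R \<mu>"] by (simp add: blinfun.scaleR_right)
  then show "(\<forall>x. \<Phi> f x \<le> norm x) \<and> \<Phi> f \<mu> = norm \<mu>" using * by simp
next
  assume "(\<forall>x. \<Phi> f x \<le> norm x) \<and> \<Phi> f \<mu> = norm \<mu>"
  then show "f \<in> norm_subdifferential \<Phi> \<mu>"
    by (simp add: norm_subdifferential_def subdifferential_def blinfun.diff_right)
qed

text \<open>The subdifferential of the norm at \<open>\<mu>\<close> consists of the linear functionals below \<open>tangent norm \<mu>\<close>,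
so that the algebraic result on sublinear functionals yields genuine extreme points.\<close>

lemma norm_subdifferential_extreme_maximizer:
  fixes \<Phi> :: "'b::banach \<Rightarrow> 'p::banach \<Rightarrow>\<^sub>L real"
  assumes pre: "predual \<Phi>"
  obtains e where "e extreme_point_of norm_subdifferential \<Phi> \<mu>"
    "\<And>f. f \<in> norm_subdifferential \<Phi> \<mu> \<Longrightarrow> \<Phi> f \<omega> \<le> \<Phi> e \<omega>"
proof -
  define p :: "'p \<Rightarrow> real" where "p = tangent norm \<mu>"
  have p: "sublinear p" unfolding p_def by (intro sublinear_tangent sublinear_norm)
  have lin: "linear (blinfun_apply U)" for U :: "'p \<Rightarrow>\<^sub>L real"
    by (simp add: blinfun.bounded_linear_right bounded_linear.linear)
  have mem: "f \<in> norm_subdifferential \<Phi> \<mu> \<longleftrightarrow> blinfun_apply (\<Phi> f) \<le> p" for f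
    unfolding in_norm_subdifferential_iff p_def le_fun_def
    using linear_below_tangent_iff[OF sublinear_norm lin] by blast
  obtain u where u: "linear u" "u \<le> p" "u \<omega> = p \<omega>" and
    ext: "\<And>a b t. \<lbrakk>linear a; linear b; a \<le> p; b \<le> p; 0 < t; t < 1; u = (\<lambda>y. (1 - t) * a y + t * b y)\<rbrakk>
       \<Longrightarrow> a = u \<and> b = u"
    using extreme_linear_below_sublinear_at[OF p, of \<omega>] by blast
  have "u x \<le> 1 * norm x" for x
    using u(2) tangent_self[OF sublinear_norm, of \<mu> x] by (auto simp: p_def le_fun_def intro: order_trans)
  then obtain U where U: "blinfun_apply U = u"
    using blinfun_of_linear_bounded[OF u(1), of 1] by auto
  obtain e where e: "\<Phi> e = U" using predual_surj[OF pre] by blast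
  have "e extreme_point_of norm_subdifferential \<Phi> \<mu>"
    unfolding extreme_point_of_def
  proof (intro conjI ballI notI)
    show "e \<in> norm_subdifferential \<Phi> \<mu>" using mem u(2) by (simp add: e U)
    fix a b assume ab: "a \<in> norm_subdifferential \<Phi> \<mu>" "b \<in> norm_subdifferential \<Phi> \<mu>"
      and "e \<in> open_segment a b"
    then obtain t where t: "a \<noteq> b" "0 < t" "t < 1" "e = (1 - t) *\<^sub>R a + t *\<^sub>R b"
      by (auto simp: in_segment)
    have "U = (1 - t) *\<^sub>R \<Phi> a + t *\<^sub>R \<Phi> b"
      unfolding e[symmetric] t(4) by (simp add: linear_add linear_cmul predual_linear[OF pre])
    then have "u = (\<lambda>y. (1 - t) * \<Phi> a y + t * \<Phi> b y)"
      unfolding U[symmetric] by (simp add: blinfun.add_left blinfun.scaleR_left fun_eq_iff)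
    then have "blinfun_apply (\<Phi> a) = blinfun_apply (\<Phi> b)"
      using ext[OF lin lin _ _ t(2,3)] ab by (metis mem)
    then show False
      using t(1) predual_inj[OF pre] by (simp add: blinfun_apply_inject inj_eq)
  qed
  moreover have "\<Phi> f \<omega> \<le> \<Phi> e \<omega>" if "f \<in> norm_subdifferential \<Phi> \<mu>" for f
    using that u(3) by (simp add: mem e U le_fun_def)
  ultimately show thesis by (rule that)
qed

text \<open>The step of the induction subtracts from \<open>f\<close> the multiple of \<open>g0\<close> that makes the difference vanish
at a point \<open>\<omega>0\<close> of the common kernel of \<open>G\<close> where \<open>f\<close> does not vanish. Each point of that kernel
is a multiple of \<open>\<omega>0\<close> plus a point where \<open>g0\<close> vanishes too.\<close>

lemma in_span_if_vanishes_on_common_kernel: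
  fixes G :: "('p::real_normed_vector \<Rightarrow>\<^sub>L real) set"
  assumes "finite G" "\<And>\<omega>. (\<And>g. g \<in> G \<Longrightarrow> blinfun_apply g \<omega> = 0) \<Longrightarrow> blinfun_apply f \<omega> = 0"
  shows "f \<in> span G"
  using assms
proof (induction G arbitrary: f rule: finite_induct)
  case empty
  then have "f = 0" by (intro blinfun_eqI) simp
  then show ?case by simp
next
  case (insert g0 G)
  show ?case
  proof (cases "\<forall>\<omega>. (\<forall>g\<in>G. blinfun_apply g \<omega> = 0) \<longrightarrow> blinfun_apply f \<omega> = 0")
    case True
    then have "f \<in> span G" by (intro insert.IH) blast
    then show ?thesis using span_mono[of G "insert g0 G"] by blast
  next
    case False
    then obtain \<omega>0 where \<omega>0: "\<And>g. g \<in> G \<Longrightarrow> blinfun_apply g \<omega>0 = 0" "blinfun_apply f \<omega>0 \<noteq> 0" by blast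
    then have g0: "blinfun_apply g0 \<omega>0 \<noteq> 0" using insert.prems[of \<omega>0] by blast
    define a where "a = blinfun_apply f \<omega>0 / blinfun_apply g0 \<omega>0"
    have "f - a *\<^sub>R g0 \<in> span G"
    proof (rule insert.IH)
      fix \<omega> assume \<omega>: "\<And>g. g \<in> G \<Longrightarrow> blinfun_apply g \<omega> = 0"
      \<comment> \<open>The projection of \<open>\<omega>\<close> along \<open>\<omega>0\<close> to the kernel of \<open>g0\<close>.\<close>
      let ?w = "\<omega> - (g0 \<omega> / g0 \<omega>0) *\<^sub>R \<omega>0"
      have "blinfun_apply f ?w = 0"
        by (rule insert.prems)
          (use \<omega> \<omega>0 g0 in \<open>auto simp: blinfun.diff_right blinfun.scaleR_right\<close>)
      then show "blinfun_apply (f - a *\<^sub>R g0) \<omega> = 0"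
        by (simp add: blinfun.diff_right blinfun.scaleR_right blinfun.diff_left blinfun.scaleR_left a_def)
    qed
    then have "f - a *\<^sub>R g0 \<in> span (insert g0 G)" using span_mono[of G "insert g0 G"] by blast
    moreover have "a *\<^sub>R g0 \<in> span (insert g0 G)" by (intro span_scale span_base) simp
    ultimately show ?thesis using span_add by fastforce
  qed
qed

text \<open>If \<open>\<omega>\<close> vanishes on the extreme points, then the maxima of \<open>\<omega>\<close> and of \<open>- \<omega>\<close> over the
subdifferential are \<open>0\<close>, as both are attained at extreme points.\<close>

lemma norm_subdifferential_subset_span_extreme:
  fixes \<Phi> :: "'b::banach \<Rightarrow> 'p::banach \<Rightarrow>\<^sub>L real"
  assumes pre: "predual \<Phi>" and fin: "finite {e. e extreme_point_of norm_subdifferential \<Phi> \<mu>}"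
  shows "norm_subdifferential \<Phi> \<mu> \<subseteq> span {e. e extreme_point_of norm_subdifferential \<Phi> \<mu>}"
    (is "?A \<subseteq> span ?E")
proof
  fix f assume f: "f \<in> ?A"
  have "\<Phi> f \<in> span (\<Phi> ` ?E)"
  proof (rule in_span_if_vanishes_on_common_kernel)
    fix \<omega> assume zero: "\<And>g. g \<in> \<Phi> ` ?E \<Longrightarrow> blinfun_apply g \<omega> = 0"
    have "\<Phi> f \<omega>' \<le> 0" if "\<omega>' = \<omega> \<or> \<omega>' = - \<omega>" for \<omega>'
    proof -
      obtain e where "e \<in> ?E" "\<Phi> f \<omega>' \<le> \<Phi> e \<omega>'"
        using norm_subdifferential_extreme_maximizer[OF pre, of \<mu> \<omega>'] f by blast
      moreover then have "\<Phi> e \<omega>' = 0" using zero[of "\<Phi> e"] that by (auto simp: blinfun.minus_right)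
      ultimately show ?thesis by simp
    qed
    from this[of \<omega>] this[of "- \<omega>"] show "\<Phi> f \<omega> = 0" by (simp add: blinfun.minus_right)
  qed (use fin in simp)
  also have "span (\<Phi> ` ?E) = \<Phi> ` span ?E"
    by (rule linear_span_image[OF predual_linear[OF pre]])
  finally show "f \<in> span ?E" using predual_inj[OF pre] by (auto simp: inj_eq)
qed


section \<open>Existence of regularized solutions\<close>

lemma lower_semicontinuous_on_nhds:
  assumes "lower_semicontinuous_on S F" "x \<in> S" "c < F x"
  shows "eventually (\<lambda>y. y \<in> S \<longrightarrow> c < F y) (nhds x)"
proof -
  have "eventually (\<lambda>y. y \<noteq> x \<longrightarrow> y \<in> S \<longrightarrow> c < F y) (nhds x)"
    using assms unfolding lower_semicontinuous_on_def eventually_at_filter by blast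
  then show ?thesis by (rule eventually_mono) (use assms(3) in auto)
qed

text \<open>Otherwise each \<open>x \<in> D\<close> has a better point \<open>b x\<close>, which remains better throughout a neighbourhood
of \<open>x\<close>. Finitely many neighbourhoods cover \<open>D\<close>, and the best of the finitely many points \<open>b x\<close>
lies in one of them: a contradiction.\<close>

lemma lower_semicontinuous_on_attains_inf:
  fixes G :: "'a::topological_space \<Rightarrow> real"
  assumes D: "compact D" "D \<noteq> {}" and lsc: "lower_semicontinuous_on D G"
  obtains x where "x \<in> D" "\<And>y. y \<in> D \<Longrightarrow> G x \<le> G y"
proof (rule ccontr)
  assume "\<not> thesis"
  then have "\<forall>x\<in>D. \<exists>y\<in>D. G y < G x" using that by (meson not_le)
  then obtain b where b: "\<And>x. x \<in> D \<Longrightarrow> b x \<in> D \<and> G (b x) < G x" by metis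
  have "\<exists>W. open W \<and> x \<in> W \<and> (\<forall>w\<in>W. w \<in> D \<longrightarrow> G (b x) < G w)" if x: "x \<in> D" for x
    using lower_semicontinuous_on_nhds[OF lsc x, of "G (b x)"] b[OF x]
    unfolding eventually_nhds by blast
  then obtain W where W: "\<And>x. x \<in> D \<Longrightarrow> open (W x) \<and> x \<in> W x \<and> (\<forall>w\<in>W x. w \<in> D \<longrightarrow> G (b x) < G w)"
    by metis
  have op: "open (W x)" if "x \<in> D" for x using W[OF that] by blast
  have "D \<subseteq> (\<Union>x\<in>D. W x)" using W by blast
  then obtain D0 where D0: "D0 \<subseteq> D" "finite D0" "D \<subseteq> (\<Union>x\<in>D0. W x)"
    using compactE_image[OF D(1), of D W] op by blast
  have ne: "D0 \<noteq> {}" using D0(3) D(2) by blast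
  define x where "x = arg_min_on (\<lambda>w. G (b w)) D0"
  have x: "x \<in> D0" unfolding x_def by (rule arg_min_if_finite(1)[OF D0(2) ne])
  have "b x \<in> D" using b x D0(1) by blast
  then obtain w where w: "w \<in> D0" "b x \<in> W w" using D0(3) by blast
  then have "G (b w) < G (b x)" using W[of w] D0(1) \<open>b x \<in> D\<close> by blast
  moreover have "G (b x) \<le> G (b w)" unfolding x_def by (rule arg_min_least[OF D0(2) ne w(1)])
  ultimately show False by simp
qed

lemma lower_semicontinuous_on_sum_prod:
  fixes F :: "'a::topological_space \<Rightarrow> real" and H :: "'b::topological_space \<Rightarrow> real"
  assumes F: "lower_semicontinuous_on A F" and H: "lower_semicontinuous_on B H"
    and D: "D \<subseteq> A \<times> B" and l: "l > 0"
  shows "lower_semicontinuous_on D (\<lambda>w. F (fst w) + l * H (snd w))"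
  unfolding lower_semicontinuous_on_def
proof (intro ballI allI impI)
  fix w c assume w: "w \<in> D" and c: "c < F (fst w) + l * H (snd w)"
  \<comment> \<open>Half of the gap for each of the two summands.\<close>
  define e where "e = (F (fst w) + l * H (snd w) - c) / 2"
  have e: "e > 0" using c by (simp add: e_def)
  have wA: "fst w \<in> A" "snd w \<in> B" using w D by auto
  have 1: "eventually (\<lambda>y. fst y \<in> A \<longrightarrow> F (fst w) - e < F (fst y)) (nhds w)"
    by (rule eventually_compose_filterlim[OF
          lower_semicontinuous_on_nhds[OF F wA(1)] tendsto_fst[OF filterlim_ident]])
      (use e in simp)
  have 2: "eventually (\<lambda>y. snd y \<in> B \<longrightarrow> H (snd w) - e / l < H (snd y)) (nhds w)"
    by (rule eventually_compose_filterlim[OF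
          lower_semicontinuous_on_nhds[OF H wA(2)] tendsto_snd[OF filterlim_ident]])
      (use e l in simp)
  have "eventually (\<lambda>y. y \<in> D \<longrightarrow> c < F (fst y) + l * H (snd y)) (nhds w)"
    using 1 2
  proof eventually_elim
    case (elim y)
    show ?case
    proof
      assume "y \<in> D"
      then have F': "F (fst w) - e < F (fst y)" and H': "H (snd w) - e / l < H (snd y)"
        using elim D by auto
      have "l * H (snd w) - e < l * H (snd y)"
        using mult_strict_left_mono[OF H' l] l by (simp add: right_diff_distrib)
      with F' show "c < F (fst y) + l * H (snd y)" by (simp add: e_def field_simps)
    qed
  qed
  then show "eventually (\<lambda>y. c < F (fst y) + l * H (snd y)) (at w within D)"
    unfolding eventually_at_filter by (rule eventually_mono) simp
qed

lemma functional_data_map: "blinfun_apply (\<Phi> f) (combination \<nu> c) = data_map \<Phi> \<nu> f \<bullet> c"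
  by (rule blinfun_combination) (simp add: data_map_def)

lemma data_map_inner_le:
  assumes "predual \<Phi>"
  shows "data_map \<Phi> \<nu> f \<bullet> c \<le> norm f * norm (combination \<nu> c)"
proof -
  have "\<bar>\<Phi> f (combination \<nu> c)\<bar> \<le> norm (\<Phi> f) * norm (combination \<nu> c)"
    using norm_blinfun[of "\<Phi> f" "combination \<nu> c"] by simp
  then show ?thesis by (simp add: functional_data_map predual_norm[OF assms])
qed

text \<open>Together with the preceding inequality this describes the pairs of data and norm bounds that occur
by a family of closed conditions on finitely many real numbers.\<close>

lemma element_with_prescribed_data:
  assumes pre: "predual \<Phi>" and r: "r \<ge> 0" and bd: "\<And>c. z \<bullet> c \<le> r * norm (combination \<nu> c)"
  obtains f where "norm f \<le> r" "data_map \<Phi> \<nu> f = z"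
proof -
  obtain U where U: "norm U \<le> r" "\<And>i. blinfun_apply U (\<nu> i) = z $ i"
    using functional_with_prescribed_values[OF r bd] by blast
  obtain f where "\<Phi> f = U" using predual_surj[OF pre] .
  then show thesis using that[of f] U predual_norm[OF pre, of f] by (simp add: data_map_def vec_eq_iff)
qed

lemma linear_data_map: "predual \<Phi> \<Longrightarrow> linear (data_map \<Phi> \<nu>)"
  by (rule linearI)
    (simp_all add: data_map_def vec_eq_iff linear_add[OF predual_linear] linear_cmul[OF predual_linear]
      blinfun.add_left blinfun.scaleR_left)

text \<open>Taking \<open>c = fst w\<close> in the defining inequality bounds \<open>norm (fst w)\<close> in terms of \<open>T\<close>.\<close>

lemma compact_attainable_data:
  "compact {w::(real^'n) \<times> real. 0 \<le> snd w \<and> snd w \<le> T \<and>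
     (\<forall>c. fst w \<bullet> c \<le> snd w * norm (combination \<nu> c))}" (is "compact ?D")
proof -
  have "closed ?D"
    by (intro closed_Collect_conj closed_Collect_all closed_Collect_le continuous_intros)
  moreover have "bounded ?D"
  proof (rule boundedI)
    fix w assume w: "w \<in> ?D"
    let ?z = "fst w" and ?S = "\<Sum>i\<in>UNIV. norm (\<nu> i)"
    have "norm ?z * norm ?z = ?z \<bullet> ?z" by (simp add: dot_square_norm power2_eq_square)
    also have "\<dots> \<le> snd w * norm (combination \<nu> ?z)" using w by simp
    also have "\<dots> \<le> T * (norm ?z * ?S)"
      using w by (intro mult_mono norm_combination_le) auto
    finally have "norm ?z * norm ?z \<le> norm ?z * (T * ?S)" by (simp add: mult_ac)
    moreover have "0 \<le> T * ?S" using w by (intro mult_nonneg_nonneg sum_nonneg) auto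
    ultimately have "norm ?z \<le> T * ?S"
      by (cases "?z = 0") auto
    then show "norm w \<le> T * ?S + T"
      using w norm_Pair_le[of ?z "snd w"] by simp
  qed
  ultimately show ?thesis by (simp add: compact_eq_bounded_closed)
qed

text \<open>Coercivity allows norms above some \<open>T\<close> to be disregarded, since they cost at least as much as the
zero element. On the compact set of the attainable pairs of data and norm bounds up to \<open>T\<close> the
lower semicontinuous objective has a minimum, and monotonicity of \<open>\<phi>\<close> passes from the norm bound
to the norm of an element that realizes the pair.\<close>

lemma regularized_solutions_nonempty:
  assumes pre: "predual \<Phi>" and lam: "lam > 0"
    and Q0: "\<forall>z. Q z \<ge> 0" and Q: "lower_semicontinuous_on UNIV Q"
    and phi: "lower_semicontinuous_on {0..} \<phi>" and mono: "mono_on {0..} \<phi>"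
    and coercive: "filterlim \<phi> at_top at_top"
  shows "regularized_solutions \<Phi> \<nu> Q lam \<phi> \<noteq> {}"
proof -
  define G where "G w = Q (fst w) + lam * \<phi> (snd w)" for w
  obtain T0 where T0: "\<And>t. t \<ge> T0 \<Longrightarrow> \<phi> t \<ge> G (0, 0) / lam"
    using coercive unfolding filterlim_at_top eventually_at_top_linorder by blast
  \<comment> \<open>The maximum makes \<open>(0, 0)\<close> attainable even if the threshold from coercivity is negative.\<close>
  define T where "T = max T0 0"
  define D where "D = {w. 0 \<le> snd w \<and> snd w \<le> T \<and> (\<forall>c. fst w \<bullet> c \<le> snd w * norm (combination \<nu> c))}"
  have zero: "(0, 0) \<in> D" by (simp add: D_def T_def)
  have "lower_semicontinuous_on D G"
    unfolding G_def using Q phi _ lam by (rule lower_semicontinuous_on_sum_prod) (auto simp: D_def)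
  moreover have "compact D" unfolding D_def by (rule compact_attainable_data)
  ultimately obtain w where w: "w \<in> D" and min: "\<And>v. v \<in> D \<Longrightarrow> G w \<le> G v"
    using lower_semicontinuous_on_attains_inf[of D G] zero by blast
  obtain f where f: "norm f \<le> snd w" "data_map \<Phi> \<nu> f = fst w"
    using element_with_prescribed_data[OF pre, of "snd w" "fst w" \<nu>] w by (auto simp: D_def)
  have fw: "Q (data_map \<Phi> \<nu> f) + lam * \<phi> (norm f) \<le> G w"
    using mono_onD[OF mono _ _ f(1)] f(1) lam norm_ge_zero[of f] by (simp add: G_def f(2))
  have "G w \<le> Q (data_map \<Phi> \<nu> g) + lam * \<phi> (norm g)" for g
  proof (cases "norm g \<le> T")
    case True
    then have "(data_map \<Phi> \<nu> g, norm g) \<in> D" by (simp add: D_def data_map_inner_le[OF pre])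
    from min[OF this] show ?thesis by (simp add: G_def)
  next
    case False
    then have "\<phi> (norm g) \<ge> G (0, 0) / lam" by (intro T0) (simp add: T_def)
    then have "lam * \<phi> (norm g) \<ge> G (0, 0)" using lam by (simp add: field_simps)
    then show ?thesis using min[OF zero] Q0 by (smt (verit))
  qed
  then have "f \<in> regularized_solutions \<Phi> \<nu> Q lam \<phi>"
    using fw by (auto simp: regularized_solutions_def is_arg_min_def not_less intro: order_trans)
  then show ?thesis by blast
qed

lemma interpolant_in_regularized_solutions:
  assumes "f \<in> regularized_solutions \<Phi> \<nu> Q lam \<phi>" "lam > 0" "mono_on {0..} \<phi>"
    and "data_map \<Phi> \<nu> g = data_map \<Phi> \<nu> f" "norm g \<le> norm f"
  shows "g \<in> regularized_solutions \<Phi> \<nu> Q lam \<phi>"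
proof -
  have "\<phi> (norm g) \<le> \<phi> (norm f)" using assms(3,5) by (auto intro: mono_onD)
  then have "Q (data_map \<Phi> \<nu> g) + lam * \<phi> (norm g) \<le> Q (data_map \<Phi> \<nu> f) + lam * \<phi> (norm f)"
    using assms(2,4) by simp
  then show ?thesis
    using assms(1) by (auto simp: regularized_solutions_def is_arg_min_def not_less intro: order_trans)
qed

lemma regularized_solution_norm_minimal:
  assumes f: "f \<in> regularized_solutions \<Phi> \<nu> Q lam \<phi>" and "lam > 0" "strict_mono_on {0..} \<phi>"
    and eq: "data_map \<Phi> \<nu> g = data_map \<Phi> \<nu> f"
  shows "norm f \<le> norm g"
proof (rule ccontr)
  assume "\<not> norm f \<le> norm g"
  then have "\<phi> (norm g) < \<phi> (norm f)" using assms(3) by (auto intro: strict_mono_onD)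
  then have "Q (data_map \<Phi> \<nu> g) + lam * \<phi> (norm g) < Q (data_map \<Phi> \<nu> f) + lam * \<phi> (norm f)"
    using assms(2) eq by simp
  then show False using f by (auto simp: regularized_solutions_def is_arg_min_def)
qed

section \<open>Minimum norm interpolation and kernel expansions\<close>

text \<open>The point \<open>\<mu>\<close> is a norming combination for \<open>z\<close>, scaled so that its norm is the minimal norm \<open>r\<close>.
All interpolants have the same value \<open>r * r\<close> at \<open>\<mu>\<close>. This bounds their norms below by \<open>r\<close>, and
those of norm \<open>r\<close> attain their norm at \<open>\<mu>\<close>.\<close>

lemma minimum_norm_interpolation:
  assumes pre: "predual \<Phi>" and inj: "inj \<nu>" and ind: "independent (range \<nu>)" and z: "z \<noteq> 0"
  obtains \<mu> where "\<mu> \<in> span (range \<nu>)" "\<mu> \<noteq> 0" "\<exists>f. data_map \<Phi> \<nu> f = z \<and> norm f = norm \<mu>"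
    "\<And>f. data_map \<Phi> \<nu> f = z \<Longrightarrow> norm \<mu> \<le> norm f"
    "\<And>f. data_map \<Phi> \<nu> f = z \<Longrightarrow> norm f = norm \<mu> \<Longrightarrow> f /\<^sub>R norm \<mu> \<in> norm_subdifferential \<Phi> \<mu>"
proof -
  obtain c r where r: "r > 0" and c0: "combination \<nu> c \<noteq> 0"
    and zc: "z \<bullet> c = r * norm (combination \<nu> c)"
    and bd: "\<And>d. z \<bullet> d \<le> r * norm (combination \<nu> d)"
    using norming_combination[OF inj ind z] by blast
  \<comment> \<open>This factor gives \<open>\<mu>\<close> the norm \<open>r\<close>, which is what ties the coefficients to \<open>norm \<mu>\<close>.\<close>
  define s where "s = r / norm (combination \<nu> c)"
  define \<mu> where "\<mu> = combination \<nu> (s *\<^sub>R c)"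
  have mu: "\<mu> = s *\<^sub>R combination \<nu> c"
    unfolding \<mu>_def by (rule linear_cmul[OF linear_combination_map])
  have s: "s > 0" using r c0 by (simp add: s_def)
  have nmu: "norm \<mu> = r" using r c0 s by (simp add: mu s_def)
  have val: "\<Phi> f \<mu> = r * r" if "data_map \<Phi> \<nu> f = z" for f
    unfolding \<mu>_def functional_data_map that inner_scaleR_right zc using c0 by (simp add: s_def)
  have low: "r \<le> norm f" if "data_map \<Phi> \<nu> f = z" for f
  proof -
    have "r * r \<le> norm f * r"
      using norm_blinfun[of "\<Phi> f" \<mu>] val[OF that] nmu predual_norm[OF pre, of f] by simp
    then show ?thesis using r by simp
  qed
  show thesis
  proof (rule that[of \<mu>])
    show "\<mu> \<in> span (range \<nu>)" unfolding \<mu>_def by (rule combination_in_span)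
    show "\<mu> \<noteq> 0" using nmu r by auto
    obtain f where "norm f \<le> r" "data_map \<Phi> \<nu> f = z"
      using element_with_prescribed_data[OF pre less_imp_le[OF r] bd] .
    then show "\<exists>f. data_map \<Phi> \<nu> f = z \<and> norm f = norm \<mu>"
      using low nmu by (metis order_antisym)
    show "norm \<mu> \<le> norm f" if "data_map \<Phi> \<nu> f = z" for f
      using low[OF that] nmu by simp
    show "f /\<^sub>R norm \<mu> \<in> norm_subdifferential \<Phi> \<mu>"
      if f: "data_map \<Phi> \<nu> f = z" "norm f = norm \<mu>" for f
    proof -
      have scale: "\<Phi> (f /\<^sub>R norm \<mu>) x = \<Phi> f x / r" for x
        by (simp add: linear_cmul[OF predual_linear[OF pre]] blinfun.scaleR_left nmu divide_inverse_commute)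
      have "\<Phi> f x \<le> norm x * r" for x
        using norm_blinfun[of "\<Phi> f" x] predual_norm[OF pre, of f] f(2) nmu by (simp add: mult.commute)
      then show ?thesis
        using val[OF f(1)] r nmu unfolding in_norm_subdifferential_iff scale by (simp add: pos_divide_le_eq)
    qed
  qed
qed

lemma l1_kernel_norm:
  assumes l1: "l1_kernel_assumption X' k C" and S: "finite S" "S \<subseteq> X'"
  shows "norm (\<Sum>t\<in>S. \<alpha> t *\<^sub>R k t) = C * (\<Sum>t\<in>S. \<bar>\<alpha> t\<bar>)"
proof -
  obtain x where x: "bij_betw x {1..card S} S" using ex_bij_betw_nat_finite_1[OF S(1)] by blast
  have "norm (\<Sum>j=1..card S. \<alpha> (x j) *\<^sub>R k (x j)) = C * (\<Sum>j=1..card S. \<bar>\<alpha> (x j)\<bar>)"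
    using l1[unfolded l1_kernel_assumption_def, rule_format, of x "card S" "\<alpha> \<circ> x"] x S(2)
    by (auto simp: bij_betw_def)
  then show ?thesis
    using sum.reindex_bij_betw[OF x, of "\<lambda>t. \<alpha> t *\<^sub>R k t"] sum.reindex_bij_betw[OF x, of "\<lambda>t. \<bar>\<alpha> t\<bar>"]
    by simp
qed

text \<open>The \<open>\<ell>\<^sup>1\<close> identity gives two distinct nodes sections at distance \<open>2 * C\<close>.\<close>

lemma l1_kernel_inj_on:
  assumes l1: "l1_kernel_assumption X' k C" and C: "C > 0"
  shows "inj_on k X'"
proof (rule inj_onI, rule ccontr)
  fix s t assume st: "s \<in> X'" "t \<in> X'" "k s = k t" "s \<noteq> t"
  have "norm (\<Sum>w\<in>{s, t}. (if w = s then 1 else - 1) *\<^sub>R k w) = C * (\<Sum>w\<in>{s, t}. \<bar>if w = s then 1 else - 1\<bar>)"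
    by (rule l1_kernel_norm[OF l1]) (use st in auto)
  then show False using st C by simp
qed

lemma kernel_expansion:
  assumes pre: "predual \<Phi>" and A1: "extreme_kernel_assumption \<Phi> V X' k N"
    and A2: "l1_kernel_assumption X' k C" and C: "C > 0"
    and \<mu>: "\<mu> \<in> V" "\<mu> \<noteq> 0" and f: "f /\<^sub>R norm \<mu> \<in> norm_subdifferential \<Phi> \<mu>"
  obtains \<alpha> where "f = (\<Sum>t\<in>N \<mu>. \<alpha> t *\<^sub>R k t)"
proof -
  let ?E = "{e. e extreme_point_of norm_subdifferential \<Phi> \<mu>}"
  have fin: "finite (N \<mu>)" and sub: "N \<mu> \<subseteq> X'" and E: "?E \<subseteq> (\<Union>y\<in>N \<mu>. {- k y, k y})"
    using A1 \<mu> by (auto simp: extreme_kernel_assumption_def)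
  have "finite ?E" using E by (rule finite_subset) (use fin in simp)
  then have "f /\<^sub>R norm \<mu> \<in> span ?E"
    using norm_subdifferential_subset_span_extreme[OF pre] f by blast
  moreover have "?E \<subseteq> span (k ` N \<mu>)"
  proof
    fix e assume "e \<in> ?E"
    then obtain y where y: "y \<in> N \<mu>" "e = - k y \<or> e = k y" using E by blast
    then have "k y \<in> span (k ` N \<mu>)" by (intro span_base) blast
    then show "e \<in> span (k ` N \<mu>)" using y(2) span_neg by blast
  qed
  ultimately have "f /\<^sub>R norm \<mu> \<in> span (k ` N \<mu>)" using span_minimal subspace_span by blast
  then have "norm \<mu> *\<^sub>R (f /\<^sub>R norm \<mu>) \<in> span (k ` N \<mu>)" by (rule span_scale)
  then have "f \<in> span (k ` N \<mu>)" using \<mu>(2) by simp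
  then obtain u where "f = (\<Sum>v\<in>k ` N \<mu>. u v *\<^sub>R v)"
    using span_finite[of "k ` N \<mu>"] fin by auto
  also have "\<dots> = (\<Sum>t\<in>N \<mu>. u (k t) *\<^sub>R k t)"
    using inj_on_subset[OF l1_kernel_inj_on[OF A2 C] sub] by (simp add: sum.reindex)
  finally show thesis by (rule that)
qed

lemma kernel_expansion_nonzero:
  assumes pre: "predual \<Phi>" and A1: "extreme_kernel_assumption \<Phi> V X' k N"
    and A2: "l1_kernel_assumption X' k C" and C: "C > 0"
    and \<mu>: "\<mu> \<in> V" "\<mu> \<noteq> 0" and f: "f /\<^sub>R norm \<mu> \<in> norm_subdifferential \<Phi> \<mu>"
  obtains S \<alpha> where "S \<subseteq> N \<mu>" "\<And>t. t \<in> S \<Longrightarrow> \<alpha> t \<noteq> 0" "f = (\<Sum>t\<in>S. \<alpha> t *\<^sub>R k t)"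
proof -
  obtain \<alpha> where f: "f = (\<Sum>t\<in>N \<mu>. \<alpha> t *\<^sub>R k t)" by (rule kernel_expansion[OF assms])
  have "finite (N \<mu>)" using A1 \<mu> by (simp add: extreme_kernel_assumption_def)
  then have "f = (\<Sum>t | t \<in> N \<mu> \<and> \<alpha> t \<noteq> 0. \<alpha> t *\<^sub>R k t)"
    unfolding f by (intro sum.mono_neutral_right) auto
  then show thesis using that[of "{t \<in> N \<mu>. \<alpha> t \<noteq> 0}" \<alpha>] by blast
qed

section \<open>Reduction of the number of nodes\<close>

text \<open>Let \<open>s\<close> have the least absolute value for which some \<open>\<alpha> t + s * \<beta> t\<close> vanishes. Up to that
size no coefficient changes its sign, so the \<open>\<ell>\<^sup>1\<close> norm changes by opposite amounts \<open>D\<close> and \<open>- D\<close>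
for \<open>s\<close> and \<open>- s\<close>. By minimality at \<open>0\<close> neither is negative.\<close>

lemma l1_exchange:
  fixes \<alpha> \<beta> :: "'t \<Rightarrow> real"
  assumes fin: "finite S" and \<beta>: "t0 \<in> S" "\<beta> t0 \<noteq> 0" and \<alpha>: "\<And>t. t \<in> S \<Longrightarrow> \<alpha> t \<noteq> 0"
    and min: "\<And>s. (\<Sum>t\<in>S. \<bar>\<alpha> t\<bar>) \<le> (\<Sum>t\<in>S. \<bar>\<alpha> t + s * \<beta> t\<bar>)"
  obtains s where "s \<noteq> 0" "(\<Sum>t\<in>S. \<bar>\<alpha> t + s * \<beta> t\<bar>) = (\<Sum>t\<in>S. \<bar>\<alpha> t\<bar>)"
    "(\<Sum>t\<in>S. \<bar>\<alpha> t - s * \<beta> t\<bar>) = (\<Sum>t\<in>S. \<bar>\<alpha> t\<bar>)" "\<exists>t\<in>S. \<alpha> t + s * \<beta> t = 0"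
proof -
  let ?B = "{t \<in> S. \<beta> t \<noteq> 0}"
  define m where "m = arg_min_on (\<lambda>t. \<bar>\<alpha> t / \<beta> t\<bar>) ?B"
  have B: "finite ?B" "?B \<noteq> {}" using fin \<beta> by auto
  have m: "m \<in> S" "\<beta> m \<noteq> 0" using arg_min_if_finite(1)[OF B] by (auto simp: m_def)
  define s where "s = - \<alpha> m / \<beta> m"
  have small: "\<bar>s * \<beta> t\<bar> \<le> \<bar>\<alpha> t\<bar>" if "t \<in> S" for t
  proof (cases "\<beta> t = 0")
    case False
    then have "\<bar>\<alpha> m / \<beta> m\<bar> \<le> \<bar>\<alpha> t / \<beta> t\<bar>"
      using arg_min_least[OF B, of t] that by (simp add: m_def)
    then have "\<bar>s\<bar> * \<bar>\<beta> t\<bar> \<le> \<bar>\<alpha> t / \<beta> t\<bar> * \<bar>\<beta> t\<bar>"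
      by (intro mult_right_mono) (auto simp: s_def)
    then show ?thesis using False by (simp add: abs_mult)
  qed simp
  define D where "D = (\<Sum>t\<in>S. sgn (\<alpha> t) * (s * \<beta> t))"
  have "\<bar>\<alpha> t + s * \<beta> t\<bar> = \<bar>\<alpha> t\<bar> + sgn (\<alpha> t) * (s * \<beta> t)"
    "\<bar>\<alpha> t - s * \<beta> t\<bar> = \<bar>\<alpha> t\<bar> - sgn (\<alpha> t) * (s * \<beta> t)" if "t \<in> S" for t
    using small[OF that] by (auto simp: sgn_if abs_if split: if_splits)
  then have sums: "(\<Sum>t\<in>S. \<bar>\<alpha> t + s * \<beta> t\<bar>) = (\<Sum>t\<in>S. \<bar>\<alpha> t\<bar>) + D"
    "(\<Sum>t\<in>S. \<bar>\<alpha> t - s * \<beta> t\<bar>) = (\<Sum>t\<in>S. \<bar>\<alpha> t\<bar>) - D"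
    by (simp_all add: D_def sum.distrib sum_subtractf)
  have "D = 0" using min[of s] min[of "- s"] sums by simp
  moreover have "s \<noteq> 0" using m \<alpha> by (simp add: s_def)
  moreover have "\<alpha> m + s * \<beta> m = 0" using m by (simp add: s_def)
  ultimately show thesis using that sums m(1) by auto
qed

text \<open>The relation is indexed by \<open>S\<close>, and not by the set of vectors, so that repeated vectors count as
dependent: take the coefficients \<open>1\<close> and \<open>- 1\<close> at two indices with the same vector.\<close>

lemma dependent_family_relation:
  fixes v :: "'t \<Rightarrow> 'a::real_vector"
  assumes fin: "finite S" and dep: "\<not> (inj_on v S \<and> independent (v ` S))"
  obtains \<beta> t0 where "t0 \<in> S" "\<beta> t0 \<noteq> 0" "(\<Sum>t\<in>S. \<beta> t *\<^sub>R v t) = 0"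
proof (cases "inj_on v S")
  case True
  then have "dependent (v ` S)" using dep by blast
  then obtain u w where u: "w \<in> v ` S" "u w \<noteq> 0" "(\<Sum>w\<in>v ` S. u w *\<^sub>R w) = 0"
    using dependent_finite[of "v ` S"] fin by auto
  then obtain t0 where "t0 \<in> S" "u (v t0) \<noteq> 0" by blast
  then show thesis using that[of t0 "u \<circ> v"] u(3) by (simp add: sum.reindex[OF True])
next
  case False
  then obtain a b where ab: "a \<in> S" "b \<in> S" "v a = v b" "a \<noteq> b" by (auto simp: inj_on_def)
  define \<beta> :: "'t \<Rightarrow> real" where "\<beta> t = (if t = a then 1 else 0) - (if t = b then 1 else 0)" for t
  have "(\<Sum>t\<in>S. \<beta> t *\<^sub>R v t) = (\<Sum>t\<in>S. (if t = a then v t else 0) - (if t = b then v t else 0))"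
    by (intro sum.cong) (auto simp: \<beta>_def)
  also have "\<dots> = 0" using ab fin by (simp add: sum_subtractf)
  finally show thesis using that[of a \<beta>] ab by (simp add: \<beta>_def)
qed

text \<open>A relation between the columns is a direction in coefficient space along which the data do not
change, and the \<open>\<ell>\<^sup>1\<close> identity turns minimality of the norm into minimality of the \<open>\<ell>\<^sup>1\<close> norm of
the coefficients. The two translates show that \<open>f\<close> is not extreme, and the vanishing coefficient
shows that the number of nodes can be reduced.\<close>

lemma minimum_norm_expansion_exchange:
  assumes pre: "predual \<Phi>" and A2: "l1_kernel_assumption X' k C" and C: "C > 0"
    and S: "finite S" "S \<subseteq> X'" and \<alpha>: "\<And>t. t \<in> S \<Longrightarrow> \<alpha> t \<noteq> 0"
    and f: "f = (\<Sum>t\<in>S. \<alpha> t *\<^sub>R k t)"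
    and min: "\<And>g. data_map \<Phi> \<nu> g = data_map \<Phi> \<nu> f \<Longrightarrow> norm f \<le> norm g"
    and dep: "\<not> (inj_on (\<lambda>t. data_map \<Phi> \<nu> (k t)) S \<and> independent ((\<lambda>t. data_map \<Phi> \<nu> (k t)) ` S))"
  obtains h \<gamma> where "h \<noteq> 0" "data_map \<Phi> \<nu> (f + h) = data_map \<Phi> \<nu> f" "norm (f + h) = norm f"
    "data_map \<Phi> \<nu> (f - h) = data_map \<Phi> \<nu> f" "norm (f - h) = norm f"
    "f + h = (\<Sum>t\<in>S. \<gamma> t *\<^sub>R k t)" "\<exists>t\<in>S. \<gamma> t = 0"
proof -
  note lin = linear_data_map[OF pre, of \<nu>]
  obtain \<beta> t0 where t0: "t0 \<in> S" "\<beta> t0 \<noteq> 0" and rel: "(\<Sum>t\<in>S. \<beta> t *\<^sub>R data_map \<Phi> \<nu> (k t)) = 0"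
    using dependent_family_relation[OF S(1) dep] by blast
  define h0 where "h0 = (\<Sum>t\<in>S. \<beta> t *\<^sub>R k t)"
  have Lh0: "data_map \<Phi> \<nu> h0 = 0"
    using rel by (simp add: h0_def linear_sum[OF lin] linear_cmul[OF lin])
  have expand: "f + s *\<^sub>R h0 = (\<Sum>t\<in>S. (\<alpha> t + s * \<beta> t) *\<^sub>R k t)" for s
    by (simp add: f h0_def scaleR_sum_right scaleR_left_distrib sum.distrib)
  have data: "data_map \<Phi> \<nu> (f + s *\<^sub>R h0) = data_map \<Phi> \<nu> f" for s
    by (simp add: linear_add[OF lin] linear_cmul[OF lin] Lh0)
  have nf: "norm f = C * (\<Sum>t\<in>S. \<bar>\<alpha> t\<bar>)"
    unfolding f by (rule l1_kernel_norm[OF A2 S])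
  have ns: "norm (f + s *\<^sub>R h0) = C * (\<Sum>t\<in>S. \<bar>\<alpha> t + s * \<beta> t\<bar>)" for s
    unfolding expand by (rule l1_kernel_norm[OF A2 S])
  have "(\<Sum>t\<in>S. \<bar>\<alpha> t\<bar>) \<le> (\<Sum>t\<in>S. \<bar>\<alpha> t + s * \<beta> t\<bar>)" for s
    using min[OF data[of s]] C by (simp add: nf ns)
  then obtain s where s: "s \<noteq> 0" "(\<Sum>t\<in>S. \<bar>\<alpha> t + s * \<beta> t\<bar>) = (\<Sum>t\<in>S. \<bar>\<alpha> t\<bar>)"
    "(\<Sum>t\<in>S. \<bar>\<alpha> t - s * \<beta> t\<bar>) = (\<Sum>t\<in>S. \<bar>\<alpha> t\<bar>)" "\<exists>t\<in>S. \<alpha> t + s * \<beta> t = 0"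
    using l1_exchange[of S t0 \<beta> \<alpha>] S(1) t0 \<alpha> by blast
  have "(\<Sum>t\<in>S. \<bar>\<beta> t\<bar>) > 0" using t0 S(1) by (intro sum_pos2[of _ t0]) auto
  then have "norm h0 > 0" using C by (simp add: h0_def l1_kernel_norm[OF A2 S])
  show thesis
  proof (rule that[of "s *\<^sub>R h0" "\<lambda>t. \<alpha> t + s * \<beta> t"])
    show "s *\<^sub>R h0 \<noteq> 0" using s(1) \<open>norm h0 > 0\<close> by auto
    show "norm (f + s *\<^sub>R h0) = norm f" by (simp add: nf ns s(2))
    show "norm (f - s *\<^sub>R h0) = norm f" using ns[of "- s"] by (simp add: nf s(3))
    show "data_map \<Phi> \<nu> (f - s *\<^sub>R h0) = data_map \<Phi> \<nu> f" using data[of "- s"] by simp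
  qed (use data expand s(4) in auto)
qed

text \<open>Independent columns at the nodes in use bound their number by the rank, and the \<open>\<ell>\<^sup>1\<close> identity reads
the sum of the moduli of the coefficients off the norm of \<open>f\<close>.\<close>

lemma sparse_kernel_formI:
  assumes \<mu>: "\<mu> \<in> span (range \<nu>)" "\<mu> \<noteq> 0" and fin: "finite (N \<mu>)"
    and A2: "l1_kernel_assumption X' k C" and C: "C > 0"
    and S: "S \<subseteq> N \<mu>" "N \<mu> \<subseteq> X'" and \<alpha>: "\<And>t. t \<in> S \<Longrightarrow> \<alpha> t \<noteq> 0"
    and f: "f = (\<Sum>t\<in>S. \<alpha> t *\<^sub>R k t)" and nf: "norm f = norm \<mu>"
    and ind: "inj_on (\<lambda>t. data_map \<Phi> \<nu> (k t)) S" "independent ((\<lambda>t. data_map \<Phi> \<nu> (k t)) ` S)"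
  shows "sparse_kernel_form \<Phi> \<nu> k N C f"
proof -
  have finS: "finite S" using S(1) fin by (rule finite_subset)
  have "norm f = C * (\<Sum>t\<in>S. \<bar>\<alpha> t\<bar>)"
    unfolding f using finS S by (intro l1_kernel_norm[OF A2]) auto
  then have sum: "(\<Sum>t\<in>S. \<bar>\<alpha> t\<bar>) = norm \<mu> / C" using nf C by (simp add: field_simps)
  have "S \<noteq> {}" using f nf \<mu>(2) by auto
  obtain x where x: "bij_betw x {1..card S} S" using ex_bij_betw_nat_finite_1[OF finS] by blast
  have "card S = card ((\<lambda>t. data_map \<Phi> \<nu> (k t)) ` S)" by (simp add: card_image[OF ind(1)])
  also have "\<dots> \<le> dim ((\<lambda>t. data_map \<Phi> \<nu> (k t)) ` N \<mu>)"
    using S(1) ind(2) by (intro independent_card_le_dim) auto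
  finally have "card S \<le> matrix_rank (node_matrix \<Phi> \<nu> k) (N \<mu>)"
    by (simp add: matrix_rank_def node_matrix_def data_map_def)
  moreover have "f = (\<Sum>j=1..card S. (\<alpha> \<circ> x) j *\<^sub>R k (x j))"
    using sum.reindex_bij_betw[OF x, of "\<lambda>t. \<alpha> t *\<^sub>R k t"] by (simp add: f)
  moreover have "(\<Sum>j=1..card S. \<bar>(\<alpha> \<circ> x) j\<bar>) = norm \<mu> / C"
    using sum.reindex_bij_betw[OF x, of "\<lambda>t. \<bar>\<alpha> t\<bar>"] by (simp add: sum)
  moreover have "\<forall>j\<in>{1..card S}. x j \<in> N \<mu> \<and> (\<alpha> \<circ> x) j \<noteq> 0"
    using x S(1) \<alpha> by (auto simp: bij_betw_def)
  moreover have "0 < card S" using \<open>S \<noteq> {}\<close> finS by (simp add: card_gt_0_iff)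
  ultimately show ?thesis unfolding sparse_kernel_form_def using \<mu> by blast
qed

lemma not_extreme_point_if_both_translates:
  assumes "f + h \<in> A" "f - h \<in> A" "h \<noteq> (0::'a::real_normed_vector)"
  shows "\<not> f extreme_point_of A"
proof -
  have "f = midpoint (f + h) (f - h)" by (simp add: midpoint_def flip: scaleR_2)
  moreover have "f + h \<noteq> f - h"
  proof
    assume "f + h = f - h"
    then have "2 *\<^sub>R h = 0" by (simp add: scaleR_2 algebra_simps)
    then show False using assms(3) by simp
  qed
  ultimately have "f \<in> open_segment (f + h) (f - h)" by (metis midpoint_in_open_segment)
  then show ?thesis using assms(1,2) by (auto simp: extreme_point_of_def)
qed


section \<open>Sparse minimum norm interpolants\<close>

text \<open>Among all minimal norm interpolants and all their expansions over the nodes of \<open>\<mu>\<close>, one with the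
fewest nodes cannot be improved by the exchange.\<close>

lemma minimum_norm_interpolant_sparse_exists:
  assumes pre: "predual \<Phi>" and inj: "inj \<nu>" and ind: "independent (range \<nu>)" and z: "z \<noteq> 0"
    and A1: "extreme_kernel_assumption \<Phi> (span (range \<nu>)) X' k N"
    and A2: "l1_kernel_assumption X' k C" and C: "C > 0"
  obtains f where "data_map \<Phi> \<nu> f = z" "\<And>g. data_map \<Phi> \<nu> g = z \<Longrightarrow> norm f \<le> norm g"
    "sparse_kernel_form \<Phi> \<nu> k N C f"
proof -
  obtain \<mu> where \<mu>: "\<mu> \<in> span (range \<nu>)" "\<mu> \<noteq> 0" and ex: "\<exists>f. data_map \<Phi> \<nu> f = z \<and> norm f = norm \<mu>"
    and min: "\<And>f. data_map \<Phi> \<nu> f = z \<Longrightarrow> norm \<mu> \<le> norm f"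
    and sub: "\<And>f. data_map \<Phi> \<nu> f = z \<Longrightarrow> norm f = norm \<mu> \<Longrightarrow> f /\<^sub>R norm \<mu> \<in> norm_subdifferential \<Phi> \<mu>"
    using minimum_norm_interpolation[OF pre inj ind z] by blast
  have N: "finite (N \<mu>)" "N \<mu> \<subseteq> X'" using A1 \<mu> by (auto simp: extreme_kernel_assumption_def)
  define P where "P f S \<alpha> \<longleftrightarrow> data_map \<Phi> \<nu> f = z \<and> norm f = norm \<mu> \<and> S \<subseteq> N \<mu> \<and>
    (\<forall>t\<in>S. \<alpha> t \<noteq> 0) \<and> f = (\<Sum>t\<in>S. \<alpha> t *\<^sub>R k t)" for f S \<alpha>
  obtain f where "data_map \<Phi> \<nu> f = z" "norm f = norm \<mu>" using ex by blast
  moreover from sub[OF this] obtain S \<alpha> where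
    "S \<subseteq> N \<mu>" "\<And>t. t \<in> S \<Longrightarrow> \<alpha> t \<noteq> 0" "f = (\<Sum>t\<in>S. \<alpha> t *\<^sub>R k t)"
    using kernel_expansion_nonzero[OF pre A1 A2 C \<mu>] by blast
  ultimately have "\<exists>n f S \<alpha>. P f S \<alpha> \<and> card S = n" unfolding P_def by blast
  then have "\<exists>f S \<alpha>. P f S \<alpha> \<and> card S = (LEAST n. \<exists>f S \<alpha>. P f S \<alpha> \<and> card S = n)"
    by (rule LeastI_ex)
  then obtain f S \<alpha> where P: "P f S \<alpha>" and least: "\<And>g T \<gamma>. P g T \<gamma> \<Longrightarrow> card S \<le> card T"
    by (metis (mono_tags, lifting) Least_le)
  have f: "data_map \<Phi> \<nu> f = z" "norm f = norm \<mu>" and S: "S \<subseteq> N \<mu>"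
    and \<alpha>: "\<And>t. t \<in> S \<Longrightarrow> \<alpha> t \<noteq> 0" and sum: "f = (\<Sum>t\<in>S. \<alpha> t *\<^sub>R k t)"
    using P unfolding P_def by blast+
  have finS: "finite S" using S N(1) by (rule finite_subset)
  have SX: "S \<subseteq> X'" using S N(2) by blast
  have "inj_on (\<lambda>t. data_map \<Phi> \<nu> (k t)) S \<and> independent ((\<lambda>t. data_map \<Phi> \<nu> (k t)) ` S)"
  proof (rule ccontr)
    assume dep: "\<not> ?thesis"
    have fmin: "norm f \<le> norm g" if "data_map \<Phi> \<nu> g = data_map \<Phi> \<nu> f" for g
      using min[of g] that f by simp
    obtain h \<gamma> where h: "data_map \<Phi> \<nu> (f + h) = data_map \<Phi> \<nu> f" "norm (f + h) = norm f"
      "f + h = (\<Sum>t\<in>S. \<gamma> t *\<^sub>R k t)" "\<exists>t\<in>S. \<gamma> t = 0"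
      using minimum_norm_expansion_exchange[where \<alpha> = \<alpha> and S = S and k = k, OF pre A2 C finS SX \<alpha> sum fmin dep] by blast
    let ?T = "{t \<in> S. \<gamma> t \<noteq> 0}"
    have "f + h = (\<Sum>t\<in>?T. \<gamma> t *\<^sub>R k t)"
      unfolding h(3) using finS by (intro sum.mono_neutral_right) auto
    then have "P (f + h) ?T \<gamma>" using h f S by (auto simp: P_def)
    then have "card S \<le> card ?T" by (rule least)
    moreover have "card ?T < card S" using h(4) finS by (intro psubset_card_mono) auto
    ultimately show False by simp
  qed
  then have "sparse_kernel_form \<Phi> \<nu> k N C f"
    using sparse_kernel_formI[where \<alpha> = \<alpha> and S = S and N = N and k = k and \<mu> = \<mu>, OF \<mu> N(1) A2 C S N(2) \<alpha> sum f(2)] by blast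
  then show thesis using that[of f] f min by simp
qed

text \<open>The set \<open>A\<close> stands for the set of all regularized solutions: it may contain elements with other
data, but extremality of \<open>f\<close> only has to be tested against the minimal norm interpolants of the
data of \<open>f\<close>.\<close>

lemma minimum_norm_interpolant_extreme_sparse:
  assumes pre: "predual \<Phi>" and inj: "inj \<nu>" and ind: "independent (range \<nu>)"
    and A1: "extreme_kernel_assumption \<Phi> (span (range \<nu>)) X' k N"
    and A2: "l1_kernel_assumption X' k C" and C: "C > 0"
    and z: "data_map \<Phi> \<nu> f \<noteq> 0"
    and fmin: "\<And>g. data_map \<Phi> \<nu> g = data_map \<Phi> \<nu> f \<Longrightarrow> norm f \<le> norm g"
    and ext: "f extreme_point_of A"
    and A: "\<And>g. data_map \<Phi> \<nu> g = data_map \<Phi> \<nu> f \<Longrightarrow> norm g = norm f \<Longrightarrow> g \<in> A"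
  shows "sparse_kernel_form \<Phi> \<nu> k N C f"
proof -
  obtain \<mu> where \<mu>: "\<mu> \<in> span (range \<nu>)" "\<mu> \<noteq> 0"
    and ex: "\<exists>g. data_map \<Phi> \<nu> g = data_map \<Phi> \<nu> f \<and> norm g = norm \<mu>"
    and min: "\<And>g. data_map \<Phi> \<nu> g = data_map \<Phi> \<nu> f \<Longrightarrow> norm \<mu> \<le> norm g"
    and sub: "\<And>g. data_map \<Phi> \<nu> g = data_map \<Phi> \<nu> f \<Longrightarrow> norm g = norm \<mu>
      \<Longrightarrow> g /\<^sub>R norm \<mu> \<in> norm_subdifferential \<Phi> \<mu>"
    using minimum_norm_interpolation[OF pre inj ind z] by blast
  have nf: "norm f = norm \<mu>" using ex min fmin by (metis order_antisym)
  have N: "finite (N \<mu>)" "N \<mu> \<subseteq> X'" using A1 \<mu> by (auto simp: extreme_kernel_assumption_def)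
  obtain S \<alpha> where S: "S \<subseteq> N \<mu>" and \<alpha>: "\<And>t. t \<in> S \<Longrightarrow> \<alpha> t \<noteq> 0" and sum: "f = (\<Sum>t\<in>S. \<alpha> t *\<^sub>R k t)"
    using kernel_expansion_nonzero[OF pre A1 A2 C \<mu> sub[OF refl nf]] by blast
  have finS: "finite S" using S N(1) by (rule finite_subset)
  have SX: "S \<subseteq> X'" using S N(2) by blast
  have "inj_on (\<lambda>t. data_map \<Phi> \<nu> (k t)) S \<and> independent ((\<lambda>t. data_map \<Phi> \<nu> (k t)) ` S)"
  proof (rule ccontr)
    assume dep: "\<not> ?thesis"
    obtain h where "h \<noteq> 0" "f + h \<in> A" "f - h \<in> A"
      using minimum_norm_expansion_exchange[where \<alpha> = \<alpha> and S = S and k = k, OF pre A2 C finS SX \<alpha> sum fmin dep] A by metis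
    then show False using not_extreme_point_if_both_translates ext by blast
  qed
  then show ?thesis
    using sparse_kernel_formI[where \<alpha> = \<alpha> and S = S and N = N and k = k and \<mu> = \<mu>, OF \<mu> N(1) A2 C S N(2) \<alpha> sum nf] by blast
qed

theorem theorem12:
  fixes X :: "'x set" and ev :: "'b::banach \<Rightarrow> 'x \<Rightarrow> real"
    and X' :: "'y set" and ev' :: "'c::banach \<Rightarrow> 'y \<Rightarrow> real"
    and J :: "'c \<Rightarrow> 'b \<Rightarrow>\<^sub>L real"
    and K :: "'x \<Rightarrow> 'y \<Rightarrow> real"
    and \<Phi> :: "'b \<Rightarrow> 'p::banach \<Rightarrow>\<^sub>L real"
    and \<nu> :: "'n::finite \<Rightarrow> 'p"
    and Q :: "real ^ 'n \<Rightarrow> real ^ 'n \<Rightarrow> real" and y\<^sub>0 :: "real ^ 'n"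
    and lam :: real and \<phi> :: "real \<Rightarrow> real"
    and N :: "'p \<Rightarrow> 'y set" and C :: real
  assumes "rkbs_pair X ev X' ev' J K"
    and "predual \<Phi>"
    and "inj \<nu>" and "independent (range \<nu>)"
    and "lam > 0"
    and "\<forall>z. Q y\<^sub>0 z \<ge> 0" and "lower_semicontinuous_on UNIV (Q y\<^sub>0)"
    and "\<forall>t\<ge>0. \<phi> t \<ge> 0" and "lower_semicontinuous_on {0..} \<phi>"
    and "mono_on {0..} \<phi>" and "filterlim \<phi> at_top at_top"
    and "extreme_kernel_assumption \<Phi> (span (range \<nu>)) X' (kernel_section X ev K) N"
    and "C > 0" and "l1_kernel_assumption X' (kernel_section X ev K) C"
  shows
    "(data_map \<Phi> \<nu> ` regularized_solutions \<Phi> \<nu> (Q y\<^sub>0) lam \<phi> \<noteq> {0} \<longrightarrow>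
        (\<exists>f \<in> regularized_solutions \<Phi> \<nu> (Q y\<^sub>0) lam \<phi>.
           sparse_kernel_form \<Phi> \<nu> (kernel_section X ev K) N C f)) \<and>
     (convex_on UNIV (Q y\<^sub>0) \<and> convex_on {0..} \<phi> \<and> strict_mono_on {0..} \<phi> \<longrightarrow>
        (\<forall>f. f extreme_point_of regularized_solutions \<Phi> \<nu> (Q y\<^sub>0) lam \<phi> \<and> f \<noteq> 0 \<longrightarrow>
           sparse_kernel_form \<Phi> \<nu> (kernel_section X ev K) N C f))"
proof (intro conjI impI allI)
  let ?R = "regularized_solutions \<Phi> \<nu> (Q y\<^sub>0) lam \<phi>" and ?k = "kernel_section X ev K"
  assume data: "data_map \<Phi> \<nu> ` ?R \<noteq> {0}"
  have "?R \<noteq> {}"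
    by (rule regularized_solutions_nonempty[OF assms(2,5,6,7,9,10,11)])
  then have "\<not> data_map \<Phi> \<nu> ` ?R \<subseteq> {0}" using data by (metis image_is_empty subset_singletonD)
  then obtain f0 where f0: "f0 \<in> ?R" "data_map \<Phi> \<nu> f0 \<noteq> 0" by blast
  obtain f where f: "data_map \<Phi> \<nu> f = data_map \<Phi> \<nu> f0" "norm f \<le> norm f0"
    "sparse_kernel_form \<Phi> \<nu> ?k N C f"
    using minimum_norm_interpolant_sparse_exists[OF assms(2,3,4) f0(2) assms(12,14,13)] by blast
  then have "f \<in> ?R" using interpolant_in_regularized_solutions[OF f0(1) assms(5,10)] by blast
  then show "\<exists>f\<in>?R. sparse_kernel_form \<Phi> \<nu> ?k N C f" using f(3) by blast
next
  let ?R = "regularized_solutions \<Phi> \<nu> (Q y\<^sub>0) lam \<phi>" and ?k = "kernel_section X ev K"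
  fix f
  assume convex: "convex_on UNIV (Q y\<^sub>0) \<and> convex_on {0..} \<phi> \<and> strict_mono_on {0..} \<phi>"
    and f: "f extreme_point_of ?R \<and> f \<noteq> 0"
  have fR: "f \<in> ?R" using f by (simp add: extreme_point_of_def)
  have fmin: "norm f \<le> norm g" if "data_map \<Phi> \<nu> g = data_map \<Phi> \<nu> f" for g
    using regularized_solution_norm_minimal[OF fR assms(5) _ that] convex by blast
  \<comment> \<open>With zero data the zero element would be the minimal norm interpolant.\<close>
  have "data_map \<Phi> \<nu> f \<noteq> 0"
    using fmin[of 0] f by (auto simp add: linear_0[OF linear_data_map[OF assms(2)]])
  then show "sparse_kernel_form \<Phi> \<nu> ?k N C f"
    using f interpolant_in_regularized_solutions[OF fR assms(5,10)]
    by (intro minimum_norm_interpolant_extreme_sparse[where A = ?R, OF assms(2,3,4,12,14,13) _ fmin]) auto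
qed

end
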